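(* Let $X\subseteq\{0,1\}^{\mathbb Z}$ be a sandwich measure-theoretically subordinate subshift with base measure $\rho$ such that $h(\rho)=0$ (entropy with respect to $\sigma\times\sigma$), and let $\varphi\colon X\to\mathbb R$ be of the form $\varphi(x)=\varphi(x_0)$. Then \[ \mathcal P_{X,\varphi}=\rho(0,0)\varphi(0)+\rho(1,1)\varphi(1)+\rho(0,1)\log_2\big(2^{\varphi(0)}+2^{\varphi(1)}\big), \] where $\rho(a,b)=\rho(\{(w,x):w_0=a,\ x_0=b\})$, and there is a unique equilibrium state, namely $N_*(\rho\otimes B_p)$ with $p=2^{\varphi(0)}/(2^{\varphi(0)}+2^{\varphi(1)})$. In particular (taking $\varphi\equiv0$), $h_{top}(X)=\rho(0,1)=\nu_1(1)-\nu_0(1)$, where $\nu_0,\nu_1$ are the marginals of $\rho$, $X$ is intrinsically ergodic, and $N_*(\rho\otimes B_{1/2})$ is its unique measure of maximal entropy.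
   Context: $\sigma$ is the left shift on $\{0,1\}^{\mathbb Z}$; $\mathcal M(Y)$ is the set of shift-invariant Borel probability measures on $Y$; $\nu(1)=\nu(\{x:x_0=1\})$. $B_p$ is the Bernoulli measure on $\{0,1\}^{\mathbb Z}$ with probability $p$ of $0$ and $1-p$ of $1$. Topological pressure: $\mathcal P_{X,\varphi}=\lim_n\frac1n\log_2\sum_{A\in\mathcal L_n(X)}2^{\sup_{x\in A}\varphi^{(n)}(x)}$ with $\mathcal L_n(X)$ the $n$-blocks of $X$ and $\varphi^{(n)}=\sum_{j<n}\varphi\circ\sigma^j$; it equals $\sup_{\mu\in\mathcal M(X)}(h(\mu)+\int\varphi\,d\mu)$ (entropy base 2), and an equilibrium state is a maximizer. $N(w,x,y)=(1-y)w+yx$ coordinatewise, $\pi_{1,2}$ the projection to the first two coordinates. A subshift $X$ is a sandwich measure-theoretically subordinate subshift if there is $\rho\in\mathcal M((\{0,1\}^{\mathbb Z})^2,\sigma\times\sigma)$ with $\mathcal M(X)=\{N_*(\lambda):\lambda\in\mathcal M((\{0,1\}^{\mathbb Z})^3,\sigma^{\times3}),(\pi_{1,2})_*\lambda=\rho\}$; $\rho$ is a base measure if moreover $\rho(\{(w,x):w\le x\text{ coordinatewise}\})=1$. *)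

theory Defs
  imports "HOL-Probability.Probability"
begin

text \<open>Points of the full shift are functions int \<Rightarrow> bool (False = 0, True = 1).\<close>
type_synonym cfg = "int \<Rightarrow> bool"

definition shift :: "cfg \<Rightarrow> cfg" where
  "shift x = (\<lambda>n. x (n + 1))"

text \<open>Borel sigma-algebra of the full shift (= product sigma-algebra).\<close>
definition Sh :: "cfg measure" where
  "Sh = PiM UNIV (\<lambda>_::int. count_space (UNIV::bool set))"

definition Sh2 :: "(cfg \<times> cfg) measure" where
  "Sh2 = Sh \<Otimes>\<^sub>M Sh"

definition Sh3 :: "((cfg \<times> cfg) \<times> cfg) measure" where
  "Sh3 = Sh2 \<Otimes>\<^sub>M Sh"

text \<open>Subshift: closed (in the product topology) and shift-invariant.\<close>
definition subshift :: "cfg set \<Rightarrow> bool" where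
  "subshift X \<longleftrightarrow>
     (\<forall>x. (\<forall>n::nat. \<exists>y\<in>X. \<forall>i. \<bar>i\<bar> \<le> int n \<longrightarrow> y i = x i) \<longrightarrow> x \<in> X)
     \<and> shift ` X = X"

definition inv_meas :: "cfg measure set" where
  "inv_meas = {\<mu>. sets \<mu> = sets Sh \<and> prob_space \<mu> \<and> distr \<mu> Sh shift = \<mu>}"

definition inv_meas2 :: "(cfg \<times> cfg) measure set" where
  "inv_meas2 = {\<rho>. sets \<rho> = sets Sh2 \<and> prob_space \<rho> \<and>
      distr \<rho> Sh2 (\<lambda>(w, x). (shift w, shift x)) = \<rho>}"

definition inv_meas3 :: "((cfg \<times> cfg) \<times> cfg) measure set" where
  "inv_meas3 = {L. sets L = sets Sh3 \<and> prob_space L \<and>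
      distr L Sh3 (\<lambda>((w, x), y). ((shift w, shift x), shift y)) = L}"

definition inv_meas_on :: "cfg set \<Rightarrow> cfg measure set" where
  "inv_meas_on X = {\<mu> \<in> inv_meas. AE x in \<mu>. x \<in> X}"

text \<open>N(w,x,y) = (1-y)w + yx coordinatewise.\<close>
definition Nmap :: "(cfg \<times> cfg) \<times> cfg \<Rightarrow> cfg" where
  "Nmap t = (\<lambda>i. if snd t i then snd (fst t) i else fst (fst t) i)"

definition sandwich_sub :: "cfg set \<Rightarrow> (cfg \<times> cfg) measure \<Rightarrow> bool" where
  "sandwich_sub X \<rho> \<longleftrightarrow> subshift X \<and> \<rho> \<in> inv_meas2 \<and>
     inv_meas_on X = {distr L Sh Nmap | L. L \<in> inv_meas3 \<and> distr L Sh2 fst = \<rho>}"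

definition base_measure :: "cfg set \<Rightarrow> (cfg \<times> cfg) measure \<Rightarrow> bool" where
  "base_measure X \<rho> \<longleftrightarrow> sandwich_sub X \<rho> \<and>
     emeasure \<rho> {(w, x). \<forall>i. w i \<le> x i} = 1"

text \<open>Bernoulli measure B_p: each coordinate is 0 (False) with probability p.\<close>
definition bernoulli_shift :: "real \<Rightarrow> cfg measure" where
  "bernoulli_shift p = PiM UNIV (\<lambda>_::int. measure_pmf (bernoulli_pmf (1 - p)))"

text \<open>Measure-theoretic (Kolmogorov-Sinai) entropy, base 2, computed through the
  finite generating time-zero partition given by the coding c into a finite alphabet:
  h = lim (1/n) H(partition into n-cylinders).\<close>
definition block_entropy :: "'b measure \<Rightarrow> ('b \<Rightarrow> int \<Rightarrow> 'a::finite) \<Rightarrow> nat \<Rightarrow> real" where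
  "block_entropy M c n =
     (\<Sum>u\<in>{u::'a list. length u = n}.
        let q = measure M {\<omega> \<in> space M. \<forall>i<n. c \<omega> (int i) = u ! i} in - q * log 2 q)"

definition ks_entropy :: "'b measure \<Rightarrow> ('b \<Rightarrow> int \<Rightarrow> 'a::finite) \<Rightarrow> real" where
  "ks_entropy M c = lim (\<lambda>n. block_entropy M c n / real n)"

definition ent :: "cfg measure \<Rightarrow> real" where
  "ent \<mu> = ks_entropy \<mu> (\<lambda>x. x)"

definition ent2 :: "(cfg \<times> cfg) measure \<Rightarrow> real" where
  "ent2 \<rho> = ks_entropy \<rho> (\<lambda>(w, x) i. (w i, x i))"

definition cyl :: "cfg set \<Rightarrow> bool list \<Rightarrow> cfg set" where
  "cyl X u = {x \<in> X. \<forall>i<length u. x (int i) = u ! i}"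

definition lang :: "cfg set \<Rightarrow> nat \<Rightarrow> bool list set" where
  "lang X n = {u. length u = n \<and> cyl X u \<noteq> {}}"

definition pressure :: "cfg set \<Rightarrow> (cfg \<Rightarrow> real) \<Rightarrow> real" where
  "pressure X \<phi> = lim (\<lambda>n. log 2 (\<Sum>u\<in>lang X n.
       2 powr (SUP x\<in>cyl X u. \<Sum>j<n. \<phi> ((shift ^^ j) x))) / real n)"

definition htop :: "cfg set \<Rightarrow> real" where
  "htop X = pressure X (\<lambda>_. 0)"

definition equilibrium_state :: "cfg set \<Rightarrow> (cfg \<Rightarrow> real) \<Rightarrow> cfg measure \<Rightarrow> bool" where
  "equilibrium_state X \<phi> \<mu> \<longleftrightarrow> \<mu> \<in> inv_meas_on X \<and>
     (\<forall>\<nu>\<in>inv_meas_on X. ent \<nu> + integral\<^sup>L \<nu> \<phi> \<le> ent \<mu> + integral\<^sup>L \<mu> \<phi>)"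

definition mme :: "cfg set \<Rightarrow> cfg measure \<Rightarrow> bool" where
  "mme X \<mu> \<longleftrightarrow> \<mu> \<in> inv_meas_on X \<and> (\<forall>\<nu>\<in>inv_meas_on X. ent \<nu> \<le> ent \<mu>)"

definition intrinsically_ergodic :: "cfg set \<Rightarrow> bool" where
  "intrinsically_ergodic X \<longleftrightarrow> (\<exists>!\<mu>. mme X \<mu>)"

definition rho_at :: "(cfg \<times> cfg) measure \<Rightarrow> bool \<Rightarrow> bool \<Rightarrow> real" where
  "rho_at \<rho> a b = measure \<rho> {(w, x). w 0 = a \<and> x 0 = b}"

end

theory Submission
  imports Defs
begin

text \<open>Let \<open>\<mu> = N\<^sub>* \<lambda>\<close> for a joining \<open>\<lambda>\<close> over \<open>\<rho>\<close>. On blocks of length \<open>n\<close>, the relative entropy \<open>D\<^sub>n\<close>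
  of the law of \<open>(w, x, N(w,x,y))\<close> under \<open>\<lambda>\<close> with respect to its law under \<open>\<rho> \<otimes> B\<^sub>p\<close> equals
  \<open>n (P - \<integral>\<phi> d\<mu>) - H\<^sub>n(w,x,z) + H\<^sub>n(w,x)\<close>, where \<open>P\<close> is the claimed pressure and \<open>z = N(w,x,y)\<close>.
  It is nonnegative and superadditive in \<open>n\<close>. As \<open>H\<^sub>n(w,x) = o(n)\<close>, this gives
  \<open>h(\<mu>) + \<integral>\<phi> d\<mu> \<le> P - D\<^sub>m / m\<close> for every \<open>m\<close>, and equality forces all \<open>D\<^sub>m\<close> to vanish, that is
  \<open>\<mu> = N\<^sub>*(\<rho> \<otimes> B\<^sub>p)\<close>. Conversely \<open>D\<^sub>n = 0\<close> for \<open>\<rho> \<otimes> B\<^sub>p\<close>, and \<open>H\<^sub>n(z) \<ge> H\<^sub>n(w,x,z) - H\<^sub>n(w,x)\<close>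
  shows that the bound is attained. The pressure is identified with the supremum by
  Misiurewicz' proof of the variational principle.\<close>

section \<open>Entropy of simple random variables\<close>

text \<open>The obstacle is that \<open>N(w,x,y)\<close> forgets \<open>y\<close> wherever
  \<open>w\<close> and \<open>x\<close> agree, so different joinings may share an image and the
  joining cannot be recovered. Recording \<open>z\<close> in place of \<open>y\<close> keeps the
  base and what \<mu> sees. Given \<open>(w,x)\<close> under the product, \<open>z\<close> is forced
  where \<open>w = x\<close> and is a \<open>p\<close>-coin where \<open>w = 0\<close>,
  \<open>x = 1\<close>; the order gives the fourth cell mass zero.

  The value of \<open>p\<close> is the one for which \<open>- log 2 p + f(0)\<close> and
  \<open>- log 2 (1 - p) + f(1)\<close> both equal \<open>log 2 (2^f(0) + 2^f(1))\<close>. Expected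
  code length plus the integral of \<phi> is then the same for every joining.

  Passing to the limit alone would not give uniqueness: equality then yields only
  \<open>D_n = o(n)\<close>. Subadditivity of the conditional entropy of \<open>z\<close> given
  \<open>(w,x)\<close> is what upgrades an asymptotic equality to an exact one at each finite
  length.\<close>

definition shannon :: "'m measure \<Rightarrow> ('m \<Rightarrow> 'v) \<Rightarrow> real" where
  "shannon M V = (\<Sum>v\<in>V ` space M. let q = measure M (V -` {v} \<inter> space M) in - q * log 2 q)"

lemma simple_function_finite_state:
  fixes V :: "'m \<Rightarrow> 'v::finite"
  assumes "V \<in> measurable M (count_space UNIV)"
  shows "simple_function M V"
  using measurable_sets[OF assms] unfolding simple_function_def by auto

context prob_space
begin

definition law :: "('a \<Rightarrow> 'v) \<Rightarrow> 'v \<Rightarrow> real" where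
  "law V v = prob (V -` {v} \<inter> space M)"

lemma law_nonneg [simp]: "0 \<le> law V v"
  by (simp add: law_def)

lemma law_le_1 [simp]: "law V v \<le> 1"
  by (simp add: law_def)

lemma law_eq_0: "v \<notin> V ` space M \<Longrightarrow> law V v = 0"
proof -
  assume "v \<notin> V ` space M"
  then have "V -` {v} \<inter> space M = {}" by auto
  then show ?thesis by (simp add: law_def)
qed

lemma information_space_2: "information_space M 2"
  by unfold_locales auto

lemma shannon_eq:
  assumes V: "simple_function M V" and S: "finite S" "V ` space M \<subseteq> S"
  shows "shannon M V = (\<Sum>v\<in>S. - law V v * log 2 (law V v))"
  unfolding shannon_def Let_def law_def[symmetric]
  using S by (intro sum.mono_neutral_left) (auto simp: law_eq_0)

lemma shannon_eq_entropy:
  assumes V: "simple_function M V"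
  shows "shannon M V = entropy 2 (count_space (V ` space M)) V"
proof -
  interpret information_space M 2 by (rule information_space_2)
  show ?thesis
    using entropy_simple_distributed[OF simple_distributedI[OF V measure_nonneg refl]]
    by (simp add: shannon_def Let_def sum_negf)
qed

lemma law_comp:
  assumes V: "simple_function M V" and S: "finite S" "V ` space M \<subseteq> S"
  shows "law (\<lambda>\<omega>. h (V \<omega>)) w = (\<Sum>v\<in>{v\<in>S. h v = w}. law V v)"
proof -
  have "prob (\<Union>v\<in>{v\<in>S. h v = w}. V -` {v} \<inter> space M) = (\<Sum>v\<in>{v\<in>S. h v = w}. law V v)"
    unfolding law_def using S
    by (intro finite_measure_finite_Union)
      (auto simp: disjoint_family_on_def intro: simple_functionD(2)[OF V])
  moreover have "(\<Union>v\<in>{v\<in>S. h v = w}. V -` {v} \<inter> space M) = (\<lambda>\<omega>. h (V \<omega>)) -` {w} \<inter> space M"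
    using S by auto
  ultimately show ?thesis by (simp add: law_def)
qed

text \<open>Change of variables for finite laws: group the values of \<open>V\<close> by their image
  under \<open>h\<close>. With \<open>g\<close> the logarithm of a marginal probability it turns
  sums over blocks into entropies of factors or into one-letter sums.\<close>

lemma law_marginal:
  assumes V: "simple_function M V" and S: "finite S" "V ` space M \<subseteq> S"
    and T: "finite T" "h ` S \<subseteq> T"
  shows "(\<Sum>v\<in>S. law V v * g (h v)) = (\<Sum>w\<in>T. law (\<lambda>\<omega>. h (V \<omega>)) w * g w)"
proof -
  have "(\<Sum>v\<in>S. law V v * g (h v)) = (\<Sum>w\<in>T. \<Sum>v\<in>{v\<in>S. h v = w}. law V v * g (h v))"
    using S T by (intro sum.group[symmetric]) auto
  also have "\<dots> = (\<Sum>w\<in>T. \<Sum>v\<in>{v\<in>S. h v = w}. law V v * g w)"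
    by (intro sum.cong) auto
  also have "\<dots> = (\<Sum>w\<in>T. law (\<lambda>\<omega>. h (V \<omega>)) w * g w)"
    by (simp add: law_comp[OF V S] sum_distrib_right)
  finally show ?thesis .
qed

lemma sum_law:
  assumes V: "simple_function M V" and S: "finite S" "V ` space M \<subseteq> S"
  shows "(\<Sum>v\<in>S. law V v) = 1"
proof -
  have "law (\<lambda>_. ()) () = 1" by (simp add: law_def prob_space)
  moreover have "(\<Sum>v\<in>S. law V v * 1) = (\<Sum>w\<in>{()}. law (\<lambda>_. ()) w * 1)"
    by (rule law_marginal[OF V S, where g="\<lambda>_. 1" and h="\<lambda>_. ()"]) auto
  ultimately show ?thesis by simp
qed

lemma law_le_comp:
  assumes V: "simple_function M V"
  shows "law V v \<le> law (\<lambda>\<omega>. h (V \<omega>)) (h v)"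
  unfolding law_def
proof (rule finite_measure_mono)
  show "(\<lambda>\<omega>. h (V \<omega>)) -` {h v} \<inter> space M \<in> events"
    using simple_functionD(2)[OF simple_function_compose1[OF V, of h]] .
qed auto

end

section \<open>Gibbs' inequality with its equality case\<close>

lemma log_ratio_ge:
  fixes p q :: real
  assumes "0 \<le> p" "0 \<le> q" "p > 0 \<Longrightarrow> q > 0"
  shows "p * log 2 p - p * log 2 q \<ge> (p - q) / ln 2"
    and "p * log 2 p - p * log 2 q = (p - q) / ln 2 \<Longrightarrow> p = q"
proof -
  have *: "p * ln p - p * ln q \<ge> p - q \<and> (p * ln p - p * ln q = p - q \<longrightarrow> p = q)"
  proof (cases "p = 0")
    case False
    then have p: "p > 0" "q > 0" using assms by auto
    have l: "ln (q / p) \<le> q / p - 1" using p by (intro ln_le_minus_one) auto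
    have e: "p * ln p - p * ln q = - p * ln (q / p)"
      using p by (simp add: ln_div algebra_simps)
    have "p * ln (q / p) \<le> p * (q / p - 1)" using l p by (intro mult_left_mono) auto
    also have "p * (q / p - 1) = q - p" using p by (simp add: field_simps)
    finally have 1: "p * ln (q / p) \<le> q - p" .
    have "p = q" if "p * ln (q / p) = q - p"
    proof -
      have "ln (q / p) = q / p - 1" using that p by (simp add: field_simps)
      then have "q / p = 1" using p by (intro ln_eq_minus_one) auto
      then show ?thesis using p by simp
    qed
    then show ?thesis using 1 e by auto
  qed (use assms in auto)
  have ln2: "ln (2::real) > 0" by simp
  have e: "p * log 2 p - p * log 2 q = (p * ln p - p * ln q) / ln 2"
    by (simp add: log_def diff_divide_distrib)
  show "p * log 2 p - p * log 2 q \<ge> (p - q) / ln 2"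
    unfolding e using * ln2 by (intro divide_right_mono) auto
  show "p * log 2 p - p * log 2 q = (p - q) / ln 2 \<Longrightarrow> p = q"
    unfolding e using * ln2 by auto
qed

text \<open>Subtracting \<open>(p v - q v) / ln 2\<close> from each term of the relative entropy
  makes it nonnegative, by \<open>ln t \<le> t - 1\<close>, and these corrections cancel because the
  totals agree. Equality of the sums thus forces every term to vanish. The positivity assumption is
  absolute continuity; the convention \<open>log 2 0 = 0\<close> would otherwise hide infinite
  terms.\<close>

lemma gibbs:
  fixes p q :: "'v \<Rightarrow> real"
  assumes "finite S" "\<And>v. v \<in> S \<Longrightarrow> 0 \<le> p v" "\<And>v. v \<in> S \<Longrightarrow> 0 \<le> q v"
    and "\<And>v. v \<in> S \<Longrightarrow> p v > 0 \<Longrightarrow> q v > 0" and "sum p S = sum q S"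
  shows "(\<Sum>v\<in>S. - p v * log 2 (p v)) \<le> (\<Sum>v\<in>S. - p v * log 2 (q v))"
    and "(\<Sum>v\<in>S. - p v * log 2 (p v)) = (\<Sum>v\<in>S. - p v * log 2 (q v)) \<Longrightarrow> v \<in> S \<Longrightarrow> p v = q v"
proof -
  let ?d = "\<lambda>v. p v * log 2 (p v) - p v * log 2 (q v) - (p v - q v) / ln 2"
  have d: "0 \<le> ?d v" if "v \<in> S" for v
    using log_ratio_ge(1)[of "p v" "q v"] assms that by auto
  have s: "sum ?d S = (\<Sum>v\<in>S. - p v * log 2 (q v)) - (\<Sum>v\<in>S. - p v * log 2 (p v))"
    using assms(5) by (simp add: sum_subtractf sum_negf diff_divide_distrib flip: sum_divide_distrib)
  show "(\<Sum>v\<in>S. - p v * log 2 (p v)) \<le> (\<Sum>v\<in>S. - p v * log 2 (q v))"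
    using sum_nonneg[of S ?d] d s by auto
  assume "(\<Sum>v\<in>S. - p v * log 2 (p v)) = (\<Sum>v\<in>S. - p v * log 2 (q v))" and v: "v \<in> S"
  then have "sum ?d S = 0" using s by simp
  then have "?d v = 0" using sum_nonneg_eq_0_iff[OF assms(1), of ?d] d v by auto
  then show "p v = q v"
    using log_ratio_ge(2)[of "p v" "q v"] assms(2-4)[OF v] by auto
qed

context prob_space
begin

text \<open>Gibbs' inequality against the uniform distribution on \<open>S\<close>.\<close>

lemma shannon_le_log_card:
  assumes V: "simple_function M V" and S: "finite S" "V ` space M \<subseteq> S"
  shows "shannon M V \<le> log 2 (card S)"
proof -
  have ne: "S \<noteq> {}" using S not_empty by auto
  then have c: "real (card S) > 0" using S by (simp add: card_gt_0_iff)
  have "shannon M V \<le> (\<Sum>v\<in>S. - law V v * log 2 (1 / card S))"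
    unfolding shannon_eq[OF V S] using c S
    by (intro gibbs(1)) (auto simp: sum_law[OF V S])
  also have "\<dots> = log 2 (card S)"
    using c by (simp add: log_divide sum_law[OF V S] flip: sum_distrib_right)
  finally show ?thesis .
qed

lemma shannon_comp_le:
  "simple_function M V \<Longrightarrow> shannon M (\<lambda>\<omega>. h (V \<omega>)) \<le> shannon M V"
  using information_space.entropy_data_processing[OF information_space_2, of V h]
    simple_function_compose1[of M V h]
  by (simp add: shannon_eq_entropy comp_def)

lemma law_cong:
  "(\<And>\<omega>. \<omega> \<in> space M \<Longrightarrow> V \<omega> = W \<omega>) \<Longrightarrow> law V v = law W v"
  unfolding law_def by (rule arg_cong[where f=prob]) auto

lemma shannon_cong:
  assumes V: "simple_function M V" and eq: "\<And>\<omega>. \<omega> \<in> space M \<Longrightarrow> V \<omega> = W \<omega>"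
  shows "shannon M V = shannon M W"
proof -
  have W: "simple_function M W"
    using V eq by (subst simple_function_cong[of M W V]) auto
  have im: "W ` space M = V ` space M" using eq by auto
  show ?thesis
    unfolding shannon_eq[OF V simple_functionD(1)[OF V] order_refl]
      shannon_eq[OF W simple_functionD(1)[OF V], unfolded im, OF order_refl]
    using law_cong[OF eq] by simp
qed

lemma shannon_bij:
  assumes V: "simple_function M V" and W: "simple_function M W"
    and "\<And>\<omega>. \<omega> \<in> space M \<Longrightarrow> V \<omega> = f (W \<omega>)" "\<And>\<omega>. \<omega> \<in> space M \<Longrightarrow> W \<omega> = g (V \<omega>)"
  shows "shannon M V = shannon M W"
proof (rule antisym)
  have "shannon M V = shannon M (\<lambda>\<omega>. f (W \<omega>))" using assms by (intro shannon_cong) auto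
  also have "\<dots> \<le> shannon M W" using W by (rule shannon_comp_le)
  finally show "shannon M V \<le> shannon M W" .
  have "shannon M W = shannon M (\<lambda>\<omega>. g (V \<omega>))" using assms by (intro shannon_cong) auto
  also have "\<dots> \<le> shannon M V" using V by (rule shannon_comp_le)
  finally show "shannon M W \<le> shannon M V" .
qed

lemma shannon_nonneg:
  assumes V: "simple_function M V"
  shows "0 \<le> shannon M V"
  unfolding shannon_eq[OF V simple_functionD(1)[OF V] order_refl]
proof (rule sum_nonneg)
  fix v
  show "0 \<le> - law V v * log 2 (law V v)"
    by (cases "law V v = 0") (auto simp: mult_le_0_iff less_le)
qed

lemma shannon_const: "shannon M (\<lambda>_. a) = 0"
proof -
  have "law (\<lambda>_. a) a = 1" by (simp add: law_def prob_space)
  moreover have "shannon M (\<lambda>_. a) = (\<Sum>v\<in>{a}. - law (\<lambda>_. a) v * log 2 (law (\<lambda>_. a) v))"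
    by (intro shannon_eq) auto
  ultimately show ?thesis by simp
qed

text \<open>This is nonnegativity of the conditional mutual information of \<open>X\<close> and
  \<open>Y\<close> given \<open>Z\<close>, with its logarithm expanded into four entropies.\<close>

lemma shannon_submodular:
  assumes X: "simple_function M X" and Y: "simple_function M Y" and Z: "simple_function M Z"
  shows "shannon M (\<lambda>\<omega>. (X \<omega>, Y \<omega>, Z \<omega>)) + shannon M Z
    \<le> shannon M (\<lambda>\<omega>. (X \<omega>, Z \<omega>)) + shannon M (\<lambda>\<omega>. (Y \<omega>, Z \<omega>))"
proof -
  interpret information_space M 2 by (rule information_space_2)
  let ?V = "\<lambda>\<omega>. (X \<omega>, Y \<omega>, Z \<omega>)"
  let ?XZ = "\<lambda>\<omega>. (X \<omega>, Z \<omega>)" and ?YZ = "\<lambda>\<omega>. (Y \<omega>, Z \<omega>)"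
  note sp = simple_function_Pair
  have V: "simple_function M ?V" by (intro sp X Y Z)
  let ?S = "?V ` space M"
  have S: "finite ?S" using V by (rule simple_functionD)
  note sd = simple_distributedI[OF _ measure_nonneg refl]
  have "0 \<le> conditional_mutual_information 2 (count_space (X ` space M)) (count_space (Y ` space M))
      (count_space (Z ` space M)) X Y Z"
    using X Y Z by (rule conditional_mutual_information_nonneg)
  also have "\<dots> = (\<Sum>(x, y, z)\<in>?S. law ?V (x, y, z) *
      log 2 (law ?V (x, y, z) / (law ?XZ (x, z) * (law ?YZ (y, z) / law Z z))))"
    unfolding law_def
    by (rule conditional_mutual_information_eq) (intro sd sp X Y Z)+
  also have "\<dots> = (\<Sum>v\<in>?S. law ?V v * log 2 (law ?V v) - law ?V v * log 2 (law ?XZ (fst v, snd (snd v)))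
      - law ?V v * log 2 (law ?YZ (snd v)) + law ?V v * log 2 (law Z (snd (snd v))))"
  proof (rule sum.cong, simp, clarify)
    fix \<omega>
    let ?x = "X \<omega>" and ?y = "Y \<omega>" and ?z = "Z \<omega>"
    let ?a = "law ?V (?x, ?y, ?z)" and ?b = "law ?XZ (?x, ?z)" and ?c = "law ?YZ (?y, ?z)" and ?d = "law Z ?z"
    \<comment> \<open>An atom of positive probability has positive marginals, so the logarithm
      splits; null atoms contribute 0 on both sides.\<close>
    have le: "?a \<le> ?b" "?a \<le> ?c" "?a \<le> ?d"
      using law_le_comp[OF V, of "(?x, ?y, ?z)" "\<lambda>(x, y, z). (x, z)"]
        law_le_comp[OF V, of "(?x, ?y, ?z)" "\<lambda>(x, y, z). (y, z)"]
        law_le_comp[OF V, of "(?x, ?y, ?z)" "\<lambda>(x, y, z). z"] by simp_all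
    show "?a * log 2 (?a / (?b * (?c / ?d))) =
      ?a * log 2 ?a - ?a * log 2 (law ?XZ (fst (?x, ?y, ?z), snd (snd (?x, ?y, ?z))))
      - ?a * log 2 (law ?YZ (snd (?x, ?y, ?z))) + ?a * log 2 (law Z (snd (snd (?x, ?y, ?z))))"
    proof (cases "?a = 0")
      case False
      then have "?a > 0" by (simp add: less_le)
      then have "?a > 0" "?b > 0" "?c > 0" "?d > 0" using le by linarith+
      then have "log 2 (?a / (?b * (?c / ?d))) = log 2 ?a - log 2 ?b - log 2 ?c + log 2 ?d"
        by (simp add: log_divide log_mult)
      then show ?thesis
        by (simp only: fst_conv snd_conv) (simp only: right_diff_distrib distrib_left)
    qed simp
  qed
  also have "\<dots> = (\<Sum>v\<in>?S. law ?V v * log 2 (law ?V v))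
      - (\<Sum>v\<in>?S. law ?V v * log 2 (law ?XZ (fst v, snd (snd v))))
      - (\<Sum>v\<in>?S. law ?V v * log 2 (law ?YZ (snd v)))
      + (\<Sum>v\<in>?S. law ?V v * log 2 (law Z (snd (snd v))))"
    by (simp add: sum.distrib sum_subtractf)
  also have "(\<Sum>v\<in>?S. law ?V v * log 2 (law ?XZ (fst v, snd (snd v)))) = - shannon M ?XZ"
    by (subst law_marginal[OF V S order_refl, where g="\<lambda>w. log 2 (law ?XZ w)"
        and h="\<lambda>v. (fst v, snd (snd v))" and T="?XZ ` space M"])
      (auto simp: shannon_eq[OF sp[OF X Z] _ order_refl] sum_negf simple_functionD(1)[OF sp[OF X Z]])
  also have "(\<Sum>v\<in>?S. law ?V v * log 2 (law ?YZ (snd v))) = - shannon M ?YZ"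
    by (subst law_marginal[OF V S order_refl, where g="\<lambda>w. log 2 (law ?YZ w)"
        and h=snd and T="?YZ ` space M"])
      (auto simp: shannon_eq[OF sp[OF Y Z] _ order_refl] sum_negf simple_functionD(1)[OF sp[OF Y Z]])
  also have "(\<Sum>v\<in>?S. law ?V v * log 2 (law Z (snd (snd v)))) = - shannon M Z"
    by (subst law_marginal[OF V S order_refl, where g="\<lambda>w. log 2 (law Z w)"
        and h="\<lambda>v. snd (snd v)" and T="Z ` space M"])
      (auto simp: shannon_eq[OF Z _ order_refl] sum_negf simple_functionD(1)[OF Z])
  also have "(\<Sum>v\<in>?S. law ?V v * log 2 (law ?V v)) = - shannon M ?V"
    by (simp add: shannon_eq[OF V S order_refl] sum_negf)
  finally show ?thesis by simp
qed

text \<open>In conditional form: \<open>H(V,W | g V, h W) \<le> H(V | g V) + H(W | h W)\<close>. Two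
  uses of submodularity, conditioning on \<open>g V\<close> and on \<open>h W\<close>, add up with
  the terms \<open>H(g V, W)\<close> cancelling. Applied to consecutive blocks, this is the source
  of superadditivity of the relative entropy.\<close>

lemma shannon_conditional_subadditive:
  assumes V: "simple_function M V" and W: "simple_function M W"
  shows "shannon M (\<lambda>\<omega>. (V \<omega>, W \<omega>)) + shannon M (\<lambda>\<omega>. g (V \<omega>)) + shannon M (\<lambda>\<omega>. h (W \<omega>))
    \<le> shannon M V + shannon M W + shannon M (\<lambda>\<omega>. (g (V \<omega>), h (W \<omega>)))"
proof -
  note sp = simple_function_Pair
  let ?g = "\<lambda>\<omega>. g (V \<omega>)" and ?h = "\<lambda>\<omega>. h (W \<omega>)"
  have G: "simple_function M ?g" and H: "simple_function M ?h"
    using simple_function_compose1[OF V] simple_function_compose1[OF W] by auto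
  have "shannon M (\<lambda>\<omega>. (V \<omega>, W \<omega>, ?g \<omega>)) + shannon M ?g
      \<le> shannon M (\<lambda>\<omega>. (V \<omega>, ?g \<omega>)) + shannon M (\<lambda>\<omega>. (W \<omega>, ?g \<omega>))"
    by (intro shannon_submodular V W G)
  moreover have "shannon M (\<lambda>\<omega>. (V \<omega>, W \<omega>, ?g \<omega>)) = shannon M (\<lambda>\<omega>. (V \<omega>, W \<omega>))"
    by (rule shannon_bij[where f="\<lambda>(v, w). (v, w, g v)" and g="\<lambda>(v, w, u). (v, w)"])
      (auto intro!: sp V W G)
  moreover have "shannon M (\<lambda>\<omega>. (V \<omega>, ?g \<omega>)) = shannon M V"
    by (rule shannon_bij[where f="\<lambda>v. (v, g v)" and g="fst"]) (auto intro!: sp V W G)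
  moreover have "shannon M (\<lambda>\<omega>. (?g \<omega>, W \<omega>, ?h \<omega>)) + shannon M ?h
      \<le> shannon M (\<lambda>\<omega>. (?g \<omega>, ?h \<omega>)) + shannon M (\<lambda>\<omega>. (W \<omega>, ?h \<omega>))"
    by (intro shannon_submodular G W H)
  moreover have "shannon M (\<lambda>\<omega>. (?g \<omega>, W \<omega>, ?h \<omega>)) = shannon M (\<lambda>\<omega>. (W \<omega>, ?g \<omega>))"
    by (rule shannon_bij[where f="\<lambda>(w, u). (u, w, h w)" and g="\<lambda>(u, w, t). (w, u)"])
      (auto intro!: sp V W G H)
  moreover have "shannon M (\<lambda>\<omega>. (W \<omega>, ?h \<omega>)) = shannon M W"
    by (rule shannon_bij[where f="\<lambda>v. (v, h v)" and g="fst"]) (auto intro!: sp V W H)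
  ultimately show ?thesis by linarith
qed

lemma shannon_subadditive:
  assumes V: "simple_function M V" and W: "simple_function M W"
  shows "shannon M (\<lambda>\<omega>. (V \<omega>, W \<omega>)) \<le> shannon M V + shannon M W"
  using shannon_conditional_subadditive[OF V W, of "\<lambda>_. ()" "\<lambda>_. ()"] by (simp add: shannon_const)

end

section \<open>Processes with finitely many states\<close>

definition words :: "nat \<Rightarrow> 'a::finite list set" where
  "words n = {u. length u = n}"

lemma finite_words [simp]: "finite (words n :: 'a::finite list set)"
  using finite_lists_length_eq[of "UNIV :: 'a set" n] by (simp add: words_def)

lemma map_in_words [simp]: "map h u \<in> words n \<longleftrightarrow> u \<in> words n"
  by (simp add: words_def)

lemma card_words: "card (words n :: 'a::finite list set) = CARD('a) ^ n"
  using card_lists_length_eq[of "UNIV :: 'a set" n] by (simp add: words_def)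

definition block :: "('m \<Rightarrow> int \<Rightarrow> 'a) \<Rightarrow> int \<Rightarrow> nat \<Rightarrow> 'm \<Rightarrow> 'a list" where
  "block c a n \<omega> = map (\<lambda>k. c \<omega> (a + int k)) [0..<n]"

lemma length_block [simp]: "length (block c a n \<omega>) = n"
  by (simp add: block_def)

lemma block_in_words [simp]: "block c a n \<omega> \<in> words n"
  by (simp add: words_def)

lemma block_nth [simp]: "k < n \<Longrightarrow> block c a n \<omega> ! k = c \<omega> (a + int k)"
  by (simp add: block_def)

lemma block_eq_iff: "block c a n \<omega> = u \<longleftrightarrow> length u = n \<and> (\<forall>k<n. c \<omega> (a + int k) = u ! k)"
  by (auto simp: list_eq_iff_nth_eq)

lemma block_0: "block c a 0 = (\<lambda>_. [])"
  by (auto simp: block_def fun_eq_iff)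

lemma block_add: "block c a (n + m) \<omega> = block c a n \<omega> @ block c (a + int n) m \<omega>"
  by (auto simp: list_eq_iff_nth_eq nth_append add.assoc)

lemma map_block: "map h (block c a n \<omega>) = block (\<lambda>\<omega> i. h (c \<omega> i)) a n \<omega>"
  by (simp add: block_def)

text \<open>The coding \<open>c\<close> is kept apart from the sample space and from any shift, so
  that the same results serve \<mu>, \<rho>, the joinings, and the probability on finite words in
  the variational principle, which need not be stationary.\<close>

locale process = prob_space M for M :: "'m measure" +
  fixes c :: "'m \<Rightarrow> int \<Rightarrow> 'a::finite"
  assumes measurable_state: "(\<lambda>\<omega>. c \<omega> i) \<in> measurable M (count_space UNIV)"
begin

lemma simple_block [simp]: "simple_function M (block c a n)"
  unfolding simple_function_def
proof (intro conjI ballI)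
  show "finite (block c a n ` space M)"
    by (rule finite_subset[of _ "words n"]) auto
  fix u
  have "{\<omega> \<in> space M. block c a n \<omega> = u} \<in> sets M"
    unfolding block_eq_iff
  proof (intro sets.sets_Collect)
    fix k
    show "{\<omega> \<in> space M. c \<omega> (a + int k) = u ! k} \<in> events"
      using measurable_sets[OF measurable_state[of "a + int k"], of "{u ! k}"]
      by (simp add: vimage_def Int_def conj_commute)
  qed
  moreover have "block c a n -` {u} \<inter> space M = {\<omega> \<in> space M. block c a n \<omega> = u}" by auto
  ultimately show "block c a n -` {u} \<inter> space M \<in> sets M" by simp
qed

lemma process_comp: "process M (\<lambda>\<omega> i. h (c \<omega> i))"
  using measurable_compose[OF measurable_state, of h "count_space UNIV"]
  by unfold_locales auto

lemma shannon_block_eq: "shannon M (block c a n) = (\<Sum>u\<in>words n. - law (block c a n) u * log 2 (law (block c a n) u))"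
  by (rule shannon_eq) auto

lemma block_entropy_eq: "block_entropy M c n = shannon M (block c 0 n)"
proof -
  have "measure M {\<omega> \<in> space M. \<forall>i<n. c \<omega> (int i) = u ! i} = law (block c 0 n) u" if "length u = n" for u
    unfolding law_def using that
    by (intro arg_cong[where f=prob]) (auto simp: block_eq_iff)
  then show ?thesis
    unfolding shannon_block_eq block_entropy_def Let_def words_def by (intro sum.cong) auto
qed

lemma shannon_block_le: "shannon M (block c a n) \<le> n * log 2 CARD('a)"
proof -
  have "shannon M (block c a n) \<le> log 2 (card (words n :: 'a list set))"
    by (rule shannon_le_log_card) auto
  then show ?thesis by (simp add: card_words log_nat_power)
qed

lemma shannon_block_add:
  "shannon M (block c a (n + m)) = shannon M (\<lambda>\<omega>. (block c a n \<omega>, block c (a + int n) m \<omega>))"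
  by (rule shannon_bij[where f="\<lambda>(u, v). u @ v" and g="\<lambda>u. (take n u, drop n u)"])
    (auto simp: block_add intro!: simple_function_Pair)

text \<open>Conditional entropy of a block given its image under \<open>h\<close>, as a difference
  because the image is a function of the block.\<close>

definition cond_entropy :: "('a \<Rightarrow> 'b::finite) \<Rightarrow> int \<Rightarrow> nat \<Rightarrow> real" where
  "cond_entropy h a n = shannon M (block c a n) - shannon M (block (\<lambda>\<omega> i. h (c \<omega> i)) a n)"

lemma cond_entropy_add: "cond_entropy h a (n + m) \<le> cond_entropy h a n + cond_entropy h (a + int n) m"
proof -
  interpret h: process M "\<lambda>\<omega> i. h (c \<omega> i)" by (rule process_comp)
  show ?thesis
    unfolding cond_entropy_def
    using shannon_conditional_subadditive[OF simple_block[of a n] simple_block[of "a + int n" m], of "map h" "map h"]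
    unfolding map_block shannon_block_add h.shannon_block_add
    by linarith
qed

lemma shannon_block_subadditive:
  "shannon M (block c a (n + m)) \<le> shannon M (block c a n) + shannon M (block c (a + int n) m)"
  unfolding shannon_block_add by (intro shannon_subadditive) auto

lemma shannon_block_mono:
  assumes "n \<le> m"
  shows "shannon M (block c a n) \<le> shannon M (block c a m)"
proof -
  have "block c a n \<omega> = take n (block c a m \<omega>)" for \<omega>
    using block_add[of c a n "m - n" \<omega>] assms by simp
  then have "block c a n = (\<lambda>\<omega>. take n (block c a m \<omega>))" by auto
  then show ?thesis using shannon_comp_le[OF simple_block] by simp
qed

end

section \<open>Subadditive limits and stationary processes\<close>

lemma fekete:
  fixes a :: "nat \<Rightarrow> real"
  assumes sub: "\<And>n m. a (n + m) \<le> a n + a m" and nn: "\<And>n. 0 \<le> a n"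
  shows "convergent (\<lambda>n. a n / n)"
proof -
  define l where "l = (INF n\<in>{1..}. a n / real n)"
  have bdd: "bdd_below ((\<lambda>n. a n / real n) ` {1..})"
    using nn by (intro bdd_belowI[of _ 0]) auto
  have l: "l \<le> a n / n" if "n > 0" for n
    unfolding l_def using that by (intro cINF_lower bdd) auto
  have mult: "a (q * k + r) \<le> q * a k + a r" for q k r
  proof (induction q)
    case (Suc q)
    have "a (Suc q * k + r) \<le> a k + a (q * k + r)" using sub[of k "q * k + r"] by (simp add: add.assoc)
    also have "\<dots> \<le> a k + (q * a k + a r)" using Suc by simp
    finally show ?case by (simp add: algebra_simps)
  qed simp
  have "(\<lambda>n. a n / n) \<longlonglongrightarrow> l"
  proof (rule tendstoI)
    fix e :: real assume e: "e > 0"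
    obtain k where k: "k > 0" "a k / k < l + e / 2"
    proof -
      have "l < l + e / 2" using e by simp
      then have "\<exists>k\<in>{1::nat..}. a k / k < l + e / 2"
        unfolding l_def using bdd by (subst (asm) cINF_less_iff) auto
      then obtain k where "k \<in> {1::nat..}" "a k / k < l + e / 2" by blast
      then show ?thesis using that[of k] by auto
    qed
    \<comment> \<open>\<open>C\<close> bounds \<open>a (n mod k)\<close> for all remainders at once
      and vanishes after division by \<open>n\<close>; a sum serves as bound because the terms are
      nonnegative.\<close>
    define C where "C = (\<Sum>r<k. a r)"
    have C: "a r \<le> C" if "r < k" for r
      unfolding C_def using that nn by (intro member_le_sum) auto
    have "(\<lambda>n. C / real n) \<longlonglongrightarrow> 0" by (rule lim_const_over_n)
    then have "eventually (\<lambda>n. C / real n < e / 2) sequentially"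
      using e by (intro order_tendstoD(2)) auto
    then show "eventually (\<lambda>n. dist (a n / n) l < e) sequentially"
      using eventually_gt_at_top[of 0]
    proof eventually_elim
      case (elim n)
      have "a n \<le> (n div k) * a k + a (n mod k)" using mult[of "n div k" k "n mod k"] by simp
      also have "\<dots> \<le> (n / k) * a k + C"
        using nn k C[of "n mod k"] by (intro add_mono mult_right_mono) (auto simp: of_nat_div_le_of_nat)
      finally have "a n / n \<le> ((n / k) * a k + C) / n" by (intro divide_right_mono) auto
      also have "\<dots> = a k / k + C / n" using elim k by (simp add: field_simps)
      also have "\<dots> < l + e" using elim k by linarith
      finally show ?case using l[of n] elim by (simp add: dist_real_def)
    qed
  qed
  then show ?thesis by (rule convergentI)
qed

locale stationary_process = process +
  assumes stationary: "law (block c (a + 1) n) u = law (block c a n) u"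
begin

lemma stationary_nat: "law (block c (a + int k) n) u = law (block c a n) u"
proof (induction k)
  case (Suc k)
  then show ?case using stationary[of "a + int k" n u] by (simp add: algebra_simps)
qed simp

lemma shannon_shift: "shannon M (block c (a + int k) n) = shannon M (block c a n)"
  unfolding shannon_block_eq stationary_nat ..

lemma law_state: "law (\<lambda>\<omega>. c \<omega> (a + int k)) s = law (\<lambda>\<omega>. c \<omega> a) s"
proof -
  have "law (\<lambda>\<omega>. c \<omega> b) s = law (block c b 1) [s]" for b
    unfolding law_def by (intro arg_cong[where f=prob]) (auto simp: block_def)
  then show ?thesis using stationary_nat by simp
qed

lemma stationary_comp: "stationary_process M (\<lambda>\<omega> i. h (c \<omega> i))"
proof -
  interpret h: process M "\<lambda>\<omega> i. h (c \<omega> i)" by (rule process_comp)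
  show ?thesis
  proof
    fix a n u
    have "law (block (\<lambda>\<omega> i. h (c \<omega> i)) b n) u = (\<Sum>v\<in>{v\<in>words n. map h v = u}. law (block c b n) v)" for b
      using law_comp[of "block c b n" "words n" "map h" u] by (simp add: map_block image_subset_iff)
    then show "law (block (\<lambda>\<omega> i. h (c \<omega> i)) (a + 1) n) u = law (block (\<lambda>\<omega> i. h (c \<omega> i)) a n) u"
      using stationary by simp
  qed
qed

lemma cond_entropy_shift: "cond_entropy h (a + int k) n = cond_entropy h a n"
proof -
  interpret h: stationary_process M "\<lambda>\<omega> i. h (c \<omega> i)" by (rule stationary_comp)
  show ?thesis by (simp add: cond_entropy_def shannon_shift h.shannon_shift)
qed

lemma cond_entropy_mult: "cond_entropy h 0 (k * m) \<le> k * cond_entropy h 0 m"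
proof (induction k)
  case 0
  show ?case by (simp add: cond_entropy_def shannon_const block_0)
next
  case (Suc k)
  have "cond_entropy h 0 (Suc k * m) \<le> cond_entropy h 0 m + cond_entropy h (0 + int m) (k * m)"
    using cond_entropy_add[of h 0 m "k * m"] by simp
  then show ?case using Suc unfolding cond_entropy_shift by (simp add: algebra_simps)
qed

text \<open>\<open>ks_entropy\<close> is a \<open>lim\<close>, which carries information only once
  convergence is known. Stationarity turns subadditivity over adjacent blocks into the hypothesis of
  Fekete's lemma.\<close>

lemma ks_entropy_limit: "(\<lambda>n. block_entropy M c n / n) \<longlonglongrightarrow> ks_entropy M c"
proof -
  have sub: "block_entropy M c (n + m) \<le> block_entropy M c n + block_entropy M c m" for n m
    using shannon_block_subadditive[of 0 n m] shannon_shift[of 0 n m] by (simp add: block_entropy_eq)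
  have nn: "0 \<le> block_entropy M c n" for n
    by (simp add: block_entropy_eq shannon_nonneg)
  show "(\<lambda>n. block_entropy M c n / n) \<longlonglongrightarrow> ks_entropy M c"
    unfolding ks_entropy_def convergent_LIMSEQ_iff[symmetric] by (rule fekete[OF sub nn])
qed

end

section \<open>Measures on the full shift\<close>

lemma space_Sh [simp]: "space Sh = UNIV"
  by (simp add: Sh_def space_PiM)

lemma space_Sh2 [simp]: "space Sh2 = UNIV"
  by (simp add: Sh2_def space_pair_measure)

lemma space_Sh3 [simp]: "space Sh3 = UNIV"
  by (simp add: Sh3_def space_pair_measure)

lemma measurable_coord [measurable]: "(\<lambda>x. x i) \<in> measurable Sh (count_space UNIV)"
  unfolding Sh_def by measurable

lemma measurable_ShI:
  assumes "\<And>i. (\<lambda>\<omega>. g \<omega> i) \<in> measurable M (count_space UNIV)"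
  shows "g \<in> measurable M Sh"
  unfolding Sh_def using assms by (intro measurable_PiM_single') auto

lemma measurable_shift [measurable]: "shift \<in> measurable Sh Sh"
  unfolding shift_def by (intro measurable_ShI) measurable

lemma measurable_fst_Sh3 [measurable]: "fst \<in> measurable Sh3 Sh2"
  and measurable_snd_Sh3 [measurable]: "snd \<in> measurable Sh3 Sh"
  and measurable_fst_Sh2 [measurable]: "fst \<in> measurable Sh2 Sh"
  and measurable_snd_Sh2 [measurable]: "snd \<in> measurable Sh2 Sh"
  by (simp_all add: Sh3_def Sh2_def)

lemma measurable_Nmap [measurable]: "Nmap \<in> measurable Sh3 Sh"
  unfolding Nmap_def by (intro measurable_ShI) measurable

definition cylinder :: "int set \<Rightarrow> cfg \<Rightarrow> cfg set" where
  "cylinder J u = {x. \<forall>i\<in>J. x i = u i}"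

lemma cylinder_sets [measurable, simp]: "finite J \<Longrightarrow> cylinder J u \<in> sets Sh"
proof -
  assume J: "finite J"
  have "{x \<in> space Sh. \<forall>i\<in>J. x i = u i} \<in> sets Sh"
    using J by measurable
  then show ?thesis by (simp add: cylinder_def)
qed

text \<open>Boxes generate the product \<sigma>-algebra, whereas cylinders are what block laws
  control. Letting \<open>u\<close> range over extensional functions lists each pattern on
  \<open>J\<close> once, which makes the union finite and disjoint.\<close>

lemma box_decomposition:
  fixes A :: "int \<Rightarrow> bool set"
  assumes "finite J"
  shows "{x. \<forall>i\<in>J. x i \<in> A i} = (\<Union>u\<in>Pi\<^sub>E J A. cylinder J u)"
    and "disjoint_family_on (cylinder J) (Pi\<^sub>E J A)" and "finite (Pi\<^sub>E J A)"
proof -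
  have "x \<in> (\<Union>u\<in>Pi\<^sub>E J A. cylinder J u)" if "\<forall>i\<in>J. x i \<in> A i" for x :: cfg
    using that by (intro UN_I[of "restrict x J"]) (auto simp: cylinder_def)
  then show "{x. \<forall>i\<in>J. x i \<in> A i} = (\<Union>u\<in>Pi\<^sub>E J A. cylinder J u)"
    by (auto simp: cylinder_def dest: PiE_mem)
  show "disjoint_family_on (cylinder J) (Pi\<^sub>E J A)"
    unfolding disjoint_family_on_def
  proof (intro ballI impI)
    fix u v assume uv: "u \<in> Pi\<^sub>E J A" "v \<in> Pi\<^sub>E J A" "u \<noteq> v"
    then obtain i where "i \<in> J" "u i \<noteq> v i" using PiE_ext[of u J A v] by blast
    then show "cylinder J u \<inter> cylinder J v = {}" by (auto simp: cylinder_def)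
  qed
  show "finite (Pi\<^sub>E J A)"
    using assms by (intro finite_PiE) auto
qed

lemma cfg_measure_eqI:
  assumes \<mu>: "sets \<mu> = sets Sh" "prob_space \<mu>" and \<nu>: "sets \<nu> = sets Sh" "prob_space \<nu>"
    and eq: "\<And>J u. finite J \<Longrightarrow> measure \<mu> (cylinder J u) = measure \<nu> (cylinder J u)"
  shows "\<mu> = \<nu>"
proof (rule measure_eqI_PiM_infinite[where I=UNIV and M="\<lambda>_::int. count_space (UNIV::bool set)"])
  show "sets \<mu> = sets (PiM UNIV (\<lambda>_::int. count_space (UNIV::bool set)))"
    "sets \<nu> = sets (PiM UNIV (\<lambda>_::int. count_space (UNIV::bool set)))"
    using \<mu> \<nu> by (auto simp: Sh_def)
  interpret \<mu>: prob_space \<mu> by fact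
  interpret \<nu>: prob_space \<nu> by fact
  show "finite_measure \<mu>" by unfold_locales
  fix J :: "int set" and A :: "int \<Rightarrow> bool set" assume J: "finite J"
  note bd = box_decomposition[OF J, of A]
  have e: "prod_emb UNIV (\<lambda>_::int. count_space (UNIV::bool set)) J (Pi\<^sub>E J A) = (\<Union>u\<in>Pi\<^sub>E J A. cylinder J u)"
    unfolding bd(1)[symmetric] by (auto simp: prod_emb_def PiE_iff)
  have "measure \<mu> (\<Union>u\<in>Pi\<^sub>E J A. cylinder J u) = (\<Sum>u\<in>Pi\<^sub>E J A. measure \<mu> (cylinder J u))"
    using J \<mu> bd by (intro \<mu>.finite_measure_finite_Union) auto
  also have "\<dots> = (\<Sum>u\<in>Pi\<^sub>E J A. measure \<nu> (cylinder J u))"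
    using eq J by simp
  also have "\<dots> = measure \<nu> (\<Union>u\<in>Pi\<^sub>E J A. cylinder J u)"
    using J \<nu> bd by (intro \<nu>.finite_measure_finite_Union[symmetric]) auto
  finally show "emeasure \<mu> (prod_emb UNIV (\<lambda>_::int. count_space (UNIV::bool set)) J (Pi\<^sub>E J A))
    = emeasure \<nu> (prod_emb UNIV (\<lambda>_::int. count_space (UNIV::bool set)) J (Pi\<^sub>E J A))"
    unfolding e by (simp add: \<mu>.emeasure_eq_measure \<nu>.emeasure_eq_measure)
qed

lemma (in process) stationaryI:
  assumes T: "T \<in> measurable M N" and N: "sets N = sets M" and inv: "distr M N T = M"
    and c: "\<And>\<omega> i. \<omega> \<in> space M \<Longrightarrow> c (T \<omega>) i = c \<omega> (i + 1)"
  shows "stationary_process M c"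
proof
  fix a n u
  have b: "block c a n (T \<omega>) = block c (a + 1) n \<omega>" if "\<omega> \<in> space M" for \<omega>
    using c[OF that] by (auto simp: block_def algebra_simps)
  have A: "block c a n -` {u} \<inter> space M \<in> sets N"
    unfolding N by (rule simple_functionD) simp
  have "law (block c a n) u = measure (distr M N T) (block c a n -` {u} \<inter> space M)"
    by (simp add: inv law_def)
  also have "\<dots> = prob (T -` (block c a n -` {u} \<inter> space M) \<inter> space M)"
    using measure_distr[OF T A] .
  also have "T -` (block c a n -` {u} \<inter> space M) \<inter> space M = block c (a + 1) n -` {u} \<inter> space M"
    using b measurable_space[OF T] sets_eq_imp_space_eq[OF N] by auto
  finally show "law (block c (a + 1) n) u = law (block c a n) u" by (simp add: law_def)
qed

lemma processI:
  "prob_space M \<Longrightarrow> (\<And>i. (\<lambda>\<omega>. c \<omega> i) \<in> measurable M (count_space UNIV)) \<Longrightarrow> process M c"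
  by (intro process.intro process_axioms.intro)

lemma process_cfg:
  assumes "sets \<mu> = sets Sh" "prob_space \<mu>"
  shows "process \<mu> (\<lambda>x. x)"
  using assms by (intro processI) (simp_all add: measurable_cong_sets)

lemma stationary_inv_meas:
  assumes "\<mu> \<in> inv_meas"
  shows "stationary_process \<mu> (\<lambda>x. x)"
proof -
  have \<mu>: "sets \<mu> = sets Sh" "prob_space \<mu>" "distr \<mu> Sh shift = \<mu>"
    using assms by (auto simp: inv_meas_def)
  interpret process \<mu> "\<lambda>x. x" using \<mu> by (intro process_cfg)
  show ?thesis
    by (rule stationaryI[of shift Sh]) (auto simp: \<mu> shift_def measurable_cong_sets[OF \<mu>(1) refl])
qed

text \<open>A finite set of coordinates lies in a window, and invariance moves that window to start
  at 0, so initial blocks determine the measure.\<close>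

lemma inv_meas_eqI:
  assumes \<mu>: "\<mu> \<in> inv_meas" and \<nu>: "\<nu> \<in> inv_meas"
    and eq: "\<And>n u. prob_space.law \<mu> (block (\<lambda>x. x) 0 n) u = prob_space.law \<nu> (block (\<lambda>x. x) 0 n) u"
  shows "\<mu> = \<nu>"
proof (rule cfg_measure_eqI)
  interpret \<mu>: stationary_process \<mu> "\<lambda>x. x" using \<mu> by (rule stationary_inv_meas)
  interpret \<nu>: stationary_process \<nu> "\<lambda>x. x" using \<nu> by (rule stationary_inv_meas)
  show s: "sets \<mu> = sets Sh" "sets \<nu> = sets Sh" "prob_space \<mu>" "prob_space \<nu>"
    using \<mu> \<nu> by (auto simp: inv_meas_def)
  fix J :: "int set" and u :: cfg assume J: "finite J"
  \<comment> \<open>The \<open>+ 1\<close> makes the half-open window from \<open>- N\<close> to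
    \<open>N\<close> contain the largest index; \<open>insert 0\<close> covers an empty
    \<open>J\<close>.\<close>
  define N where "N = Max (insert 0 ((\<lambda>i. nat \<bar>i\<bar>) ` J)) + 1"
  have N: "- int N \<le> i \<and> i < int N" if "i \<in> J" for i
  proof -
    have "nat \<bar>i\<bar> \<le> Max (insert 0 ((\<lambda>i. nat \<bar>i\<bar>) ` J))" using J that by (intro Max_ge) auto
    then show ?thesis unfolding N_def by linarith
  qed
  define h where "h v \<longleftrightarrow> (\<forall>i\<in>J. v ! nat (i + int N) = u i)" for v :: "bool list"
  have h: "h (block (\<lambda>x. x) (- int N) (2 * N) x) \<longleftrightarrow> x \<in> cylinder J u" for x
  proof -
    have "block (\<lambda>x. x) (- int N) (2 * N) x ! nat (i + int N) = x i" if "i \<in> J" for i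
      using N[OF that] by (subst block_nth) auto
    then show ?thesis by (auto simp: h_def cylinder_def)
  qed
  have sp: "space \<mu> = UNIV" "space \<nu> = UNIV" using s(1,2)[THEN sets_eq_imp_space_eq] by auto
  have "measure \<mu> (cylinder J u) = \<mu>.law (\<lambda>x. h (block (\<lambda>x. x) (- int N) (2 * N) x)) True"
    unfolding \<mu>.law_def h sp by (intro arg_cong[where f="measure \<mu>"]) auto
  also have "\<dots> = (\<Sum>v\<in>{v\<in>words (2 * N). h v = True}. \<mu>.law (block (\<lambda>x. x) (- int N) (2 * N)) v)"
    by (rule \<mu>.law_comp) auto
  also have "\<dots> = (\<Sum>v\<in>{v\<in>words (2 * N). h v = True}. \<nu>.law (block (\<lambda>x. x) (- int N) (2 * N)) v)"
    using \<mu>.stationary_nat[of "- int N" N] \<nu>.stationary_nat[of "- int N" N] eq by simp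
  also have "\<dots> = \<nu>.law (\<lambda>x. h (block (\<lambda>x. x) (- int N) (2 * N) x)) True"
    by (rule \<nu>.law_comp[symmetric]) auto
  also have "\<dots> = measure \<nu> (cylinder J u)"
    unfolding \<nu>.law_def h sp by (intro arg_cong[where f="measure \<nu>"]) auto
  finally show "measure \<mu> (cylinder J u) = measure \<nu> (cylinder J u)" .
qed

lemma (in prob_space) law_distr:
  assumes g: "g \<in> measurable M N" and V: "simple_function N V"
  shows "prob_space.law (distr M N g) V v = law (\<lambda>\<omega>. V (g \<omega>)) v"
proof -
  interpret d: prob_space "distr M N g" by (rule prob_space_distr[OF g])
  have "d.law V v = measure M (g -` (V -` {v} \<inter> space N) \<inter> space M)"
    unfolding d.law_def using simple_functionD(2)[OF V] g by (simp add: measure_distr)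
  also have "g -` (V -` {v} \<inter> space N) \<inter> space M = (\<lambda>\<omega>. V (g \<omega>)) -` {v} \<inter> space M"
    using measurable_space[OF g] by auto
  finally show ?thesis by (simp add: law_def)
qed

lemma (in prob_space) expectation_finite_state:
  fixes V :: "'a \<Rightarrow> 'v::finite" and g :: "'v \<Rightarrow> real"
  assumes "V \<in> measurable M (count_space UNIV)"
  shows "expectation (\<lambda>\<omega>. g (V \<omega>)) = (\<Sum>v\<in>UNIV. law V v * g v)"
proof -
  have V[measurable]: "V -` {v} \<inter> space M \<in> events" for v
    using assms by (rule measurable_sets) simp
  have "expectation (\<lambda>\<omega>. g (V \<omega>)) = expectation (\<lambda>\<omega>. \<Sum>v\<in>UNIV. g v * indicator (V -` {v} \<inter> space M) \<omega>)"
    by (intro Bochner_Integration.integral_cong refl) (auto simp: indicator_def if_distrib cong: if_cong)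
  also have "\<dots> = (\<Sum>v\<in>UNIV. expectation (\<lambda>\<omega>. g v * indicator (V -` {v} \<inter> space M) \<omega>))"
    by (intro Bochner_Integration.integral_sum) (auto simp: emeasure_eq_measure)
  also have "\<dots> = (\<Sum>v\<in>UNIV. law V v * g v)"
    by (simp add: law_def mult.commute)
  finally show ?thesis .
qed

section \<open>Joinings with the base measure\<close>

definition tri :: "(cfg \<times> cfg) \<times> cfg \<Rightarrow> int \<Rightarrow> bool \<times> bool \<times> bool" where
  "tri t i = (fst (fst t) i, snd (fst t) i, Nmap t i)"

definition pair_state :: "cfg \<times> cfg \<Rightarrow> int \<Rightarrow> bool \<times> bool" where
  "pair_state = (\<lambda>(w, x) i. (w i, x i))"

definition base_state :: "bool \<times> bool \<times> bool \<Rightarrow> bool \<times> bool" where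
  "base_state s = (fst s, fst (snd s))"

text \<open>Conditional probability of the letter of \<open>z\<close> given those of
  \<open>w\<close> and \<open>x\<close> when \<open>y\<close> is Bernoulli: 0 or 1 where
  \<open>w = x\<close>, a coin where they differ.\<close>

definition channel :: "real \<Rightarrow> bool \<times> bool \<times> bool \<Rightarrow> real" where
  "channel p s = measure (measure_pmf (bernoulli_pmf (1 - p))) {y. (if y then fst (snd s) else fst s) = snd (snd s)}"

lemma base_state_tri: "base_state (tri t i) = pair_state (fst t) i"
  by (cases t) (auto simp: base_state_def tri_def pair_state_def)

lemma measurable_pair_state [measurable]: "(\<lambda>a. pair_state a i) \<in> measurable Sh2 (count_space UNIV)"
proof -
  have "(\<lambda>a. (fst a i, snd a i)) \<in> measurable Sh2 (count_space UNIV \<Otimes>\<^sub>M count_space UNIV)"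
    by measurable
  then show ?thesis
    by (simp add: pair_state_def case_prod_beta pair_measure_countable)
qed

lemma measurable_tri [measurable]: "(\<lambda>t. tri t i) \<in> measurable Sh3 (count_space UNIV)"
proof -
  have "(\<lambda>t. (fst (fst t) i, snd (fst t) i, Nmap t i))
      \<in> measurable Sh3 (count_space UNIV \<Otimes>\<^sub>M count_space UNIV \<Otimes>\<^sub>M count_space UNIV)"
    by measurable
  then show ?thesis
    by (simp add: tri_def pair_measure_countable)
qed

lemma stationary_inv_meas2:
  assumes "\<rho> \<in> inv_meas2"
  shows "stationary_process \<rho> pair_state"
proof -
  have \<rho>: "sets \<rho> = sets Sh2" "prob_space \<rho>" "distr \<rho> Sh2 (\<lambda>(w, x). (shift w, shift x)) = \<rho>"
    using assms by (auto simp: inv_meas2_def)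
  interpret process \<rho> pair_state
    using \<rho> by (intro processI) (auto simp: measurable_cong_sets[OF \<rho>(1) refl])
  have T: "(\<lambda>(w, x). (shift w, shift x)) \<in> measurable Sh2 Sh2"
  proof -
    have "(\<lambda>(w, x). (shift w, shift x)) \<in> measurable (Sh \<Otimes>\<^sub>M Sh) (Sh \<Otimes>\<^sub>M Sh)" by measurable
    then show ?thesis by (simp add: Sh2_def)
  qed
  show ?thesis
    by (rule stationaryI[OF _ _ \<rho>(3)])
      (auto simp: \<rho> shift_def pair_state_def measurable_cong_sets[OF \<rho>(1) refl] intro: T[unfolded shift_def])
qed

lemma measurable_shift3: "(\<lambda>((w, x), y). ((shift w, shift x), shift y)) \<in> measurable Sh3 Sh3"
proof -
  have "(\<lambda>t. ((shift (fst (fst t)), shift (snd (fst t))), shift (snd t)))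
      \<in> measurable ((Sh \<Otimes>\<^sub>M Sh) \<Otimes>\<^sub>M Sh) ((Sh \<Otimes>\<^sub>M Sh) \<Otimes>\<^sub>M Sh)"
    by measurable
  then show ?thesis by (simp add: Sh2_def Sh3_def case_prod_beta')
qed

lemma stationary_inv_meas3:
  assumes "L \<in> inv_meas3"
  shows "stationary_process L tri"
proof -
  have L: "sets L = sets Sh3" "prob_space L" "distr L Sh3 (\<lambda>((w, x), y). ((shift w, shift x), shift y)) = L"
    using assms by (auto simp: inv_meas3_def)
  interpret process L tri
    using L by (intro processI) (auto simp: measurable_cong_sets[OF L(1) refl])
  show ?thesis
    by (rule stationaryI[OF _ _ L(3)])
      (auto simp: L shift_def tri_def Nmap_def measurable_cong_sets[OF L(1) refl]
        intro: measurable_shift3[unfolded shift_def])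
qed

lemma distr_inv_meas:
  assumes "L \<in> inv_meas3"
  shows "distr L Sh Nmap \<in> inv_meas"
proof -
  let ?T = "\<lambda>((w, x), y). ((shift w, shift x), shift y)"
  have L: "sets L = sets Sh3" "prob_space L" "distr L Sh3 ?T = L"
    using assms by (auto simp: inv_meas3_def)
  have N: "Nmap \<in> measurable L Sh" by (simp add: measurable_cong_sets[OF L(1) refl])
  have T: "?T \<in> measurable L Sh3" using measurable_shift3 by (simp add: measurable_cong_sets[OF L(1) refl])
  have "distr (distr L Sh Nmap) Sh shift = distr L Sh (shift \<circ> Nmap)"
    by (intro distr_distr measurable_shift N)
  also have "shift \<circ> Nmap = Nmap \<circ> ?T"
    by (auto simp: fun_eq_iff shift_def Nmap_def)
  also have "distr L Sh (Nmap \<circ> ?T) = distr (distr L Sh3 ?T) Sh Nmap"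
    by (intro distr_distr[symmetric] measurable_Nmap T)
  finally show ?thesis
    using L prob_space.prob_space_distr[OF L(2) N] by (simp add: inv_meas_def)
qed

section \<open>Bernoulli measures and their product with the base measure\<close>

lemma bernoulli_box:
  fixes S :: "nat \<Rightarrow> bool set"
  shows "measure (bernoulli_shift p) {y. \<forall>i<n. y (int i) \<in> S i}
    = (\<Prod>i<n. measure (measure_pmf (bernoulli_pmf (1 - p))) (S i))"
    and "{y. \<forall>i<n. y (int i) \<in> S i} \<in> sets (bernoulli_shift p)"
    and "sets (bernoulli_shift p) = sets Sh" and "prob_space (bernoulli_shift p)"
proof -
  let ?b = "measure_pmf (bernoulli_pmf (1 - p))"
  have sets: "sets (bernoulli_shift p) = sets Sh"
    unfolding bernoulli_shift_def Sh_def by (intro sets_PiM_cong) auto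
  then show "sets (bernoulli_shift p) = sets Sh" .
  have "{y \<in> space Sh. \<forall>i<n. y (int i) \<in> S i} \<in> sets Sh" by measurable
  then show "{y. \<forall>i<n. y (int i) \<in> S i} \<in> sets (bernoulli_shift p)"
    by (simp add: sets)
  interpret P: prob_space "bernoulli_shift p"
    unfolding bernoulli_shift_def by (intro prob_space_PiM prob_space_measure_pmf)
  show "prob_space (bernoulli_shift p)" by unfold_locales
  let ?J = "int ` {..<n}" and ?A = "\<lambda>j. S (nat j)"
  have "emeasure (bernoulli_shift p) (prod_emb UNIV (\<lambda>_. ?b) ?J (Pi\<^sub>E ?J ?A)) = (\<Prod>j\<in>?J. emeasure ?b (?A j))"
    unfolding bernoulli_shift_def by (intro emeasure_PiM_emb prob_space_measure_pmf) auto
  also have "prod_emb UNIV (\<lambda>_. ?b) ?J (Pi\<^sub>E ?J ?A) = {y. \<forall>i<n. y (int i) \<in> S i}"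
    by (auto simp: prod_emb_def PiE_iff)
  also have "(\<Prod>j\<in>?J. emeasure ?b (?A j)) = ennreal (\<Prod>i<n. measure ?b (S i))"
    by (subst prod.reindex) (auto simp: inj_on_def measure_pmf.emeasure_eq_measure prod_ennreal)
  finally show "measure (bernoulli_shift p) {y. \<forall>i<n. y (int i) \<in> S i} = (\<Prod>i<n. measure ?b (S i))"
    by (simp add: P.emeasure_eq_measure prod_nonneg)
qed

lemma distr_bernoulli_shift: "distr (bernoulli_shift p) Sh shift = bernoulli_shift p"
proof -
  let ?b = "measure_pmf (bernoulli_pmf (1 - p))"
  have "distr (PiM UNIV (\<lambda>_::int. ?b)) (PiM UNIV (\<lambda>_::int. ?b)) (\<lambda>\<omega>. \<lambda>n\<in>UNIV. \<omega> (n + 1)) = PiM UNIV (\<lambda>_::int. ?b)"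
    by (rule distr_PiM_reindex) (auto simp: inj_on_def prob_space_measure_pmf)
  moreover have "distr (bernoulli_shift p) Sh shift = distr (bernoulli_shift p) (bernoulli_shift p) shift"
    by (intro distr_cong refl) (simp add: bernoulli_box(3))
  ultimately show ?thesis
    by (simp add: bernoulli_shift_def shift_def[abs_def] restrict_UNIV)
qed

context
  fixes \<rho> :: "(cfg \<times> cfg) measure"
  assumes inv: "\<rho> \<in> inv_meas2"
begin

interpretation \<rho>: stationary_process \<rho> pair_state
  by (rule stationary_inv_meas2[OF inv])

lemma sets_rho: "sets \<rho> = sets Sh2"
  using inv by (simp add: inv_meas2_def)

lemma product_inv_meas3:
  "\<rho> \<Otimes>\<^sub>M bernoulli_shift p \<in> inv_meas3"
  "distr (\<rho> \<Otimes>\<^sub>M bernoulli_shift p) Sh2 fst = \<rho>"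
proof -
  let ?B = "bernoulli_shift p" and ?T = "\<lambda>(w, x). (shift w, shift x)"
  interpret B: prob_space ?B by (rule bernoulli_box)
  interpret P: pair_prob_space \<rho> ?B ..
  have sets: "sets (\<rho> \<Otimes>\<^sub>M ?B) = sets Sh3"
    unfolding Sh3_def by (intro sets_pair_measure_cong sets_rho bernoulli_box)
  have T: "?T \<in> measurable \<rho> Sh2"
  proof -
    have "?T \<in> measurable (Sh \<Otimes>\<^sub>M Sh) (Sh \<Otimes>\<^sub>M Sh)" by measurable
    then show ?thesis by (simp add: Sh2_def measurable_cong_sets[OF sets_rho[unfolded Sh2_def] refl])
  qed
  have S: "shift \<in> measurable ?B Sh" by (simp add: measurable_cong_sets[OF bernoulli_box(3) refl])
  have d: "distr \<rho> Sh2 ?T = \<rho>" using inv by (simp add: inv_meas2_def)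
  have "distr \<rho> Sh2 ?T \<Otimes>\<^sub>M distr ?B Sh shift
      = distr (\<rho> \<Otimes>\<^sub>M ?B) (Sh2 \<Otimes>\<^sub>M Sh) (\<lambda>(a, y). (?T a, shift y))"
    by (intro pair_measure_distr T S) (simp add: distr_bernoulli_shift B.sigma_finite_measure_axioms)
  then have "distr (\<rho> \<Otimes>\<^sub>M ?B) Sh3 (\<lambda>((w, x), y). ((shift w, shift x), shift y)) = \<rho> \<Otimes>\<^sub>M ?B"
    unfolding d distr_bernoulli_shift Sh3_def by (simp add: case_prod_beta')
  then show "\<rho> \<Otimes>\<^sub>M ?B \<in> inv_meas3"
    using sets P.prob_space_axioms by (simp add: inv_meas3_def)
  have "distr (\<rho> \<Otimes>\<^sub>M ?B) Sh2 fst = distr (\<rho> \<Otimes>\<^sub>M ?B) \<rho> fst"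
    by (intro distr_cong refl) (simp add: sets_rho)
  then show "distr (\<rho> \<Otimes>\<^sub>M ?B) Sh2 fst = \<rho>"
    by (simp add: B.distr_pair_fst)
qed

text \<open>The base entropy \<open>H(w,x)\<close> is thus the same for all joinings, which lets
  \<open>ent2 \<rho> = 0\<close> act on an arbitrary one.\<close>

lemma law_base_block:
  assumes L: "L \<in> inv_meas3" "distr L Sh2 fst = \<rho>"
  shows "prob_space.law L (block (\<lambda>t i. base_state (tri t i)) a n) u = \<rho>.law (block pair_state a n) u"
proof -
  interpret L: stationary_process L tri by (rule stationary_inv_meas3[OF L(1)])
  have fst: "fst \<in> measurable L Sh2"
  proof -
    have "sets L = sets Sh3" using L by (simp add: inv_meas3_def)
    then show ?thesis using measurable_fst_Sh3 by (simp add: measurable_cong_sets[OF \<open>sets L = sets Sh3\<close> refl])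
  qed
  have s: "simple_function Sh2 (block pair_state a n)"
    using \<rho>.simple_block[of a n] unfolding simple_function_def
    by (simp add: sets_rho sets_eq_imp_space_eq[OF sets_rho])
  have "block (\<lambda>t i. base_state (tri t i)) a n = (\<lambda>t. block pair_state a n (fst t))"
    by (auto simp: base_state_tri block_def)
  then show ?thesis
    using L.law_distr[OF fst s, of u] by (simp add: L(2))
qed

text \<open>Given the base word, the letters of \<open>z\<close> are independent, each obtained
  through \<open>channel\<close>. The event is a rectangle: a base cylinder times a box of those
  \<open>y\<close> that produce the required letters.\<close>

lemma law_product:
  assumes u: "length u = n"
  shows "prob_space.law (\<rho> \<Otimes>\<^sub>M bernoulli_shift p) (block tri 0 n) u
    = \<rho>.law (block pair_state 0 n) (map base_state u) * (\<Prod>i<n. channel p (u ! i))"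
proof -
  let ?B = "bernoulli_shift p"
  interpret B: prob_space ?B by (rule bernoulli_box)
  interpret P: pair_prob_space \<rho> ?B ..
  define S where "S i = {y. (if y then fst (snd (u ! i)) else fst (u ! i)) = snd (snd (u ! i))}" for i
  have sp: "space \<rho> = UNIV" "space ?B = UNIV"
    using sets_eq_imp_space_eq[OF sets_rho] sets_eq_imp_space_eq[OF bernoulli_box(3)] by auto
  have A: "block pair_state 0 n -` {map base_state u} \<inter> space \<rho> \<in> sets \<rho>"
    by (rule simple_functionD) simp
  have "block tri 0 n -` {u} \<inter> space (\<rho> \<Otimes>\<^sub>M ?B)
      = (block pair_state 0 n -` {map base_state u} \<inter> space \<rho>) \<times> {y. \<forall>i<n. y (int i) \<in> S i}"
  proof (rule set_eqI)
    fix t :: "(cfg \<times> cfg) \<times> cfg"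
    obtain w x y where t: "t = ((w, x), y)" by (metis surj_pair)
    have "tri t (int i) = u ! i \<longleftrightarrow>
        pair_state (w, x) (int i) = base_state (u ! i) \<and> y (int i) \<in> S i" for i
      by (cases "u ! i") (auto simp: t tri_def pair_state_def base_state_def Nmap_def S_def)
    then show "t \<in> block tri 0 n -` {u} \<inter> space (\<rho> \<Otimes>\<^sub>M ?B) \<longleftrightarrow>
        t \<in> (block pair_state 0 n -` {map base_state u} \<inter> space \<rho>) \<times> {y. \<forall>i<n. y (int i) \<in> S i}"
      using u by (auto simp: t space_pair_measure sp block_eq_iff)
  qed
  then have "P.law (block tri 0 n) u = measure (\<rho> \<Otimes>\<^sub>M ?B)
      ((block pair_state 0 n -` {map base_state u} \<inter> space \<rho>) \<times> {y. \<forall>i<n. y (int i) \<in> S i})"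
    by (simp add: P.law_def)
  also have "\<dots> = \<rho>.law (block pair_state 0 n) (map base_state u) * measure ?B {y. \<forall>i<n. y (int i) \<in> S i}"
    unfolding \<rho>.law_def using A bernoulli_box(2)[of n S p]
    by (subst measure_def) (simp add: B.emeasure_pair_measure_Times enn2real_mult measure_def)
  also have "measure ?B {y. \<forall>i<n. y (int i) \<in> S i} = (\<Prod>i<n. channel p (u ! i))"
    unfolding bernoulli_box(1) channel_def S_def ..
  finally show ?thesis .
qed

text \<open>The relative entropy of the joining \<open>L\<close> with respect to \<open>\<rho> \<Otimes> B\<^sub>p\<close> on blocks of length \<open>n\<close>
  is \<open>n * cross_entropy p L - cond_entropy base_state 0 n\<close>.\<close>

definition cross_entropy :: "real \<Rightarrow> ((cfg \<times> cfg) \<times> cfg) measure \<Rightarrow> real" where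
  "cross_entropy p L = (\<Sum>s\<in>UNIV. - prob_space.law L (\<lambda>t. tri t 0) s * log 2 (channel p s))"

text \<open>Gibbs' inequality between the two block laws: its bound, its equality case, and the case
  of identical laws. The cross entropy of blocks is \<open>H(w,x)\<close> plus \<open>n\<close>
  equal one-letter terms, since the reference law factorizes over positions and \<open>L\<close> is
  stationary.\<close>

lemma joining_gibbs:
  assumes L: "L \<in> inv_meas3" "distr L Sh2 fst = \<rho>" and p: "0 < p" "p < 1"
  shows "process.cond_entropy L tri base_state 0 n \<le> n * cross_entropy p L" (is ?le)
    and "process.cond_entropy L tri base_state 0 n = n * cross_entropy p L \<Longrightarrow>
      prob_space.law L (block tri 0 n) u = prob_space.law (\<rho> \<Otimes>\<^sub>M bernoulli_shift p) (block tri 0 n) u"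
    and "L = \<rho> \<Otimes>\<^sub>M bernoulli_shift p \<Longrightarrow>
      process.cond_entropy L tri base_state 0 n = n * cross_entropy p L"
proof -
  interpret L: stationary_process L tri by (rule stationary_inv_meas3[OF L(1)])
  interpret P: stationary_process "\<rho> \<Otimes>\<^sub>M bernoulli_shift p" tri
    by (rule stationary_inv_meas3[OF product_inv_meas3(1)])
  interpret b: process L "\<lambda>t i. base_state (tri t i)" by (rule L.process_comp)
  let ?p = "L.law (block tri 0 n)" and ?q = "P.law (block tri 0 n)"
  let ?b = "block (\<lambda>t i. base_state (tri t i)) 0 n"
  have k: "channel p s > 0" if "snd (snd s) = fst s \<or> snd (snd s) = fst (snd s)" for s
  proof -
    \<comment> \<open>The coin value \<open>z \<noteq> w\<close> always produces \<open>z\<close>: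
      it is 0 if \<open>z = w\<close>, and otherwise it is 1 and \<open>z = x\<close>. Both coin
      values have positive probability.\<close>
    have "channel p s \<ge> measure (measure_pmf (bernoulli_pmf (1 - p))) {snd (snd s) \<noteq> fst s}"
      unfolding channel_def using that by (intro measure_pmf.finite_measure_mono) auto
    moreover have "measure (measure_pmf (bernoulli_pmf (1 - p))) {y} > 0" for y
      using p by (cases y) (auto simp: measure_pmf_single)
    ultimately show ?thesis by (meson less_le_trans)
  qed
  have q: "?q v = L.law ?b (map base_state v) * (\<Prod>i<n. channel p (v ! i))" if "v \<in> words n" for v
    using that law_product[of v n p] law_base_block[OF L] by (simp add: words_def)
  have tri: "v \<in> block tri 0 n ` space L" if "?p v > 0" for v
    using that L.law_eq_0[of v "block tri 0 n"] by (cases "v \<in> block tri 0 n ` space L") auto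
  have kv: "channel p (v ! i) > 0" if "?p v > 0" "i < n" for v i
  proof -
    from tri[OF that(1)] obtain t where "v = block tri 0 n t" by auto
    then show ?thesis using that(2) by (intro k) (auto simp: tri_def Nmap_def)
  qed
  have pb: "?p v \<le> L.law ?b (map base_state v)" for v
    using L.law_le_comp[OF L.simple_block, of 0 n v "map base_state"] by (simp add: map_block)
  \<comment> \<open>Absolute continuity: a triple seen under \<open>L\<close> has
    \<open>z = w\<close> or \<open>z = x\<close> in each position, and its base word is at least as
    likely as the triple word.\<close>
  have pq: "?q v > 0" if "v \<in> words n" "?p v > 0" for v
    using that kv[OF that(2)] pb[of v] unfolding q[OF that(1)]
    by (intro mult_pos_pos prod_pos) auto
  have "(\<Sum>v\<in>words n. - ?p v * log 2 (?q v))
      = (\<Sum>v\<in>words n. - (?p v * log 2 (L.law ?b (map base_state v))) + (\<Sum>i<n. - (?p v * log 2 (channel p (v ! i)))))"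
  proof (rule sum.cong)
    fix v :: "(bool \<times> bool \<times> bool) list" assume v: "v \<in> words n"
    show "- ?p v * log 2 (?q v) = - (?p v * log 2 (L.law ?b (map base_state v))) + (\<Sum>i<n. - (?p v * log 2 (channel p (v ! i))))"
    proof (cases "?p v > 0")
      case True
      have "ln (\<Prod>i<n. channel p (v ! i)) = (\<Sum>i<n. ln (channel p (v ! i)))"
      proof (intro ln_prod)
        show "channel p (v ! i) \<noteq> 0" if "i \<in> {..<n}" for i
          using kv[OF True, of i] that by auto
      qed simp
      then have "log 2 (\<Prod>i<n. channel p (v ! i)) = (\<Sum>i<n. log 2 (channel p (v ! i)))"
        by (simp add: log_def sum_divide_distrib)
      then have "log 2 (?q v) = log 2 (L.law ?b (map base_state v)) + (\<Sum>i<n. log 2 (channel p (v ! i)))"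
        unfolding q[OF v] using kv[OF True] True pb[of v]
        by (subst log_mult_pos) (auto intro!: prod_pos)
      then show ?thesis by (simp add: algebra_simps sum_distrib_left sum_negf)
    next
      case False
      then have "?p v = 0" using L.law_nonneg[of "block tri 0 n" v] by linarith
      then show ?thesis by simp
    qed
  qed simp
  also have "\<dots> = - (\<Sum>v\<in>words n. ?p v * log 2 (L.law ?b (map base_state v)))
      + (\<Sum>i<n. - (\<Sum>v\<in>words n. ?p v * log 2 (channel p (v ! i))))"
    by (simp add: sum_subtractf sum_negf sum.swap[of _ "words n"])
  also have "(\<Sum>v\<in>words n. ?p v * log 2 (L.law ?b (map base_state v)))
      = (\<Sum>w\<in>words n. L.law (\<lambda>\<omega>. map base_state (block tri 0 n \<omega>)) w * log 2 (L.law ?b w))"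
    by (rule L.law_marginal[where g="\<lambda>w. log 2 (L.law ?b w)" and h="map base_state"]) auto
  also have "\<dots> = - shannon L ?b"
    by (simp add: map_block b.shannon_block_eq sum_negf)
  also have "(\<Sum>i<n. - (\<Sum>v\<in>words n. ?p v * log 2 (channel p (v ! i)))) = (\<Sum>i<n. cross_entropy p L)"
  proof (rule sum.cong)
    fix i assume i: "i \<in> {..<n}"
    have "(\<Sum>v\<in>words n. ?p v * log 2 (channel p (v ! i)))
        = (\<Sum>s\<in>UNIV. L.law (\<lambda>\<omega>. block tri 0 n \<omega> ! i) s * log 2 (channel p s))"
      by (rule L.law_marginal[where g="\<lambda>s. log 2 (channel p s)" and h="\<lambda>v. v ! i"]) auto
    also have "\<dots> = (\<Sum>s\<in>UNIV. L.law (\<lambda>t. tri t 0) s * log 2 (channel p s))"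
      using i L.law_state[of 0 i] by simp
    finally show "- (\<Sum>v\<in>words n. ?p v * log 2 (channel p (v ! i))) = cross_entropy p L"
      by (simp add: cross_entropy_def sum_negf)
  qed simp
  finally have *: "(\<Sum>v\<in>words n. - ?p v * log 2 (?q v)) = shannon L ?b + n * cross_entropy p L" by simp
  have sum: "sum ?p (words n) = sum ?q (words n)"
    using L.sum_law[of "block tri 0 n" "words n"] P.sum_law[of "block tri 0 n" "words n"] by (simp add: image_subset_iff)
  note g = gibbs[of "words n" ?p ?q, OF _ _ _ pq sum]
  have e: "L.cond_entropy base_state 0 n = (\<Sum>v\<in>words n. - ?p v * log 2 (?p v)) - shannon L ?b"
    unfolding L.cond_entropy_def L.shannon_block_eq ..
  show "L.cond_entropy base_state 0 n \<le> n * cross_entropy p L"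
    using g(1) * e by simp
  show "?p u = ?q u" if "L.cond_entropy base_state 0 n = n * cross_entropy p L"
  proof (cases "u \<in> words n")
    case True
    then show ?thesis using g(2)[of u] * e that by simp
  next
    case False
    then have "u \<notin> block tri 0 n ` A" for A by auto
    then show ?thesis by (simp add: L.law_eq_0 P.law_eq_0)
  qed
  show "L.cond_entropy base_state 0 n = n * cross_entropy p L" if "L = \<rho> \<Otimes>\<^sub>M bernoulli_shift p"
    using * e by (simp add: that)
qed

end

section \<open>Ordered base measures and the choice of \<open>p\<close>\<close>

context
  fixes \<rho> :: "(cfg \<times> cfg) measure"
  assumes inv: "\<rho> \<in> inv_meas2"
    and ordered: "emeasure \<rho> {(w, x). \<forall>i. w i \<le> x i} = 1"
begin

interpretation \<rho>: stationary_process \<rho> pair_state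
  by (rule stationary_inv_meas2[OF inv])

lemma rho_at_eq: "rho_at \<rho> a b = \<rho>.law (\<lambda>t. pair_state t 0) (a, b)"
  using sets_eq_imp_space_eq[OF sets_rho[OF inv]]
  by (auto simp: rho_at_def \<rho>.law_def pair_state_def intro!: arg_cong[where f="measure \<rho>"])

lemma AE_ordered: "AE t in \<rho>. \<forall>i. fst t i \<le> snd t i"
proof -
  have "{t \<in> space Sh2. \<forall>i. fst t i \<longrightarrow> snd t i} \<in> sets Sh2"
    by measurable
  then have "{(w, x). \<forall>i. w i \<le> x i} \<in> sets \<rho>"
    by (simp add: sets_rho[OF inv] case_prod_beta' le_bool_def)
  then have "AE t in \<rho>. t \<in> {(w, x). \<forall>i. w i \<le> x i}"
    using ordered by (subst \<rho>.prob_eq_1[symmetric]) (auto simp: \<rho>.emeasure_eq_measure)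
  then show ?thesis by eventually_elim auto
qed

lemma rho_at_True_False: "rho_at \<rho> True False = 0"
proof -
  let ?A = "(\<lambda>t. pair_state t 0) -` {(True, False)} \<inter> space \<rho>"
  have A: "?A \<in> sets \<rho>"
    by (intro simple_functionD(2) simple_function_finite_state \<rho>.measurable_state)
  have "AE t in \<rho>. t \<notin> ?A"
    using AE_ordered by eventually_elim (auto simp: pair_state_def le_bool_def dest: spec[of _ 0])
  then show ?thesis
    unfolding rho_at_eq \<rho>.law_def using A by (simp add: \<rho>.prob_eq_0)
qed

text \<open>Both marginals contain the mass of \<open>(1,1)\<close>, which cancels, and
  \<open>(1,0)\<close> is null.\<close>

lemma rho_at_marginals:
  "measure \<rho> {(w, x). x 0 = True} - measure \<rho> {(w, x). w 0 = True} = rho_at \<rho> False True"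
proof -
  have m: "measure \<rho> {t. h (pair_state t 0)} = (\<Sum>v\<in>{v. h v}. \<rho>.law (\<lambda>t. pair_state t 0) v)" for h
  proof -
    have "simple_function \<rho> (\<lambda>t. pair_state t 0)"
      by (intro simple_function_finite_state \<rho>.measurable_state)
    from \<rho>.law_comp[OF this, of UNIV h True]
    have "\<rho>.law (\<lambda>t. h (pair_state t 0)) True = (\<Sum>v\<in>{v. h v}. \<rho>.law (\<lambda>t. pair_state t 0) v)" by simp
    moreover have "(\<lambda>t. h (pair_state t 0)) -` {True} \<inter> space \<rho> = {t. h (pair_state t 0)}"
      using sets_eq_imp_space_eq[OF sets_rho[OF inv]] by auto
    ultimately show ?thesis by (simp add: \<rho>.law_def)
  qed
  have "{(w, x). x 0 = True} = {t. snd (pair_state t 0)}" "{(w, x). w 0 = True} = {t. fst (pair_state t 0)}"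
    by (auto simp: pair_state_def)
  moreover have "{v. snd v} = {(False, True), (True, True)}" "{v. fst v} = {(True, False), (True, True)}"
    by auto
  ultimately show ?thesis
    using m[of snd] m[of fst] rho_at_True_False by (simp add: rho_at_eq)
qed

text \<open>With this \<open>p\<close> the code lengths of the two letters on the cell
  \<open>w = 0\<close>, \<open>x = 1\<close> are \<open>log 2 S - f False\<close> and
  \<open>log 2 S - f True\<close>; where \<open>w = x\<close> the channel is deterministic and costs
  nothing. Adding the integral therefore removes all dependence on the joining beyond
  \<rho>.\<close>

lemma cross_entropy_eq:
  fixes f :: "bool \<Rightarrow> real"
  defines "S \<equiv> 2 powr f False + 2 powr f True"
  assumes L: "L \<in> inv_meas3" "distr L Sh2 fst = \<rho>"
  shows "cross_entropy (2 powr f False / S) L =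
    rho_at \<rho> False False * f False + rho_at \<rho> True True * f True
           + rho_at \<rho> False True * log 2 S - (LINT x|distr L Sh Nmap. f (x 0))"
proof -
  let ?p = "2 powr f False / S"
  interpret L: stationary_process L tri by (rule stationary_inv_meas3[OF L(1)])
  have S: "S > 0" unfolding S_def by (intro add_pos_pos) auto
  have q: "1 - ?p = 2 powr f True / S" using S by (simp add: S_def field_simps)
  have p01: "0 \<le> ?p" "?p \<le> 1" using S by (auto simp: S_def)
  have setsL: "sets L = sets Sh3" using L by (simp add: inv_meas3_def)
  have N: "Nmap \<in> measurable L Sh" by (simp add: measurable_cong_sets[OF setsL refl])
  let ?l = "L.law (\<lambda>t. tri t 0)"
  have simple: "simple_function L (\<lambda>t. tri t 0)"
    by (intro simple_function_finite_state L.measurable_state)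
  have rho: "rho_at \<rho> a b = ?l (a, b, False) + ?l (a, b, True)" for a b
  proof -
    have "rho_at \<rho> a b = L.law (\<lambda>t. base_state (tri t 0)) (a, b)"
    proof -
      have "fst \<in> measurable L Sh2" using measurable_fst_Sh3 by (simp add: measurable_cong_sets[OF setsL refl])
      moreover have "simple_function Sh2 (\<lambda>t. pair_state t 0)"
        by (intro simple_function_finite_state measurable_pair_state)
      ultimately show ?thesis
        using L.law_distr[of fst Sh2 "\<lambda>t. pair_state t 0" "(a, b)"] by (simp add: L(2) rho_at_eq base_state_tri)
    qed
    also have "\<dots> = (\<Sum>v\<in>{v\<in>UNIV. base_state v = (a, b)}. ?l v)"
      by (rule L.law_comp[OF simple]) auto
    also have "{v\<in>UNIV. base_state v = (a, b)} = {(a, b, False), (a, b, True)}"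
      by (auto simp: base_state_def)
    finally show ?thesis by simp
  qed
  have zero: "?l (a, a, \<not> a) = 0" for a
  proof -
    have "(a, a, \<not> a) \<notin> (\<lambda>t. tri t 0) ` space L" by (auto simp: tri_def Nmap_def split: if_splits)
    then show ?thesis by (rule L.law_eq_0)
  qed
  \<comment> \<open>The order excludes the cell \<open>(1,0)\<close>; it would contribute with the
    roles of \<open>p\<close> and \<open>1 - p\<close> exchanged.\<close>
  have tf: "?l (True, False, b) = 0" for b
    using rho[of True False] rho_at_True_False
      add_nonneg_eq_0_iff[OF L.law_nonneg[of "\<lambda>t. tri t 0" "(True, False, False)"]
        L.law_nonneg[of "\<lambda>t. tri t 0" "(True, False, True)"]] by (cases b) auto
  have int: "(LINT x|distr L Sh Nmap. f (x 0)) = (\<Sum>s\<in>UNIV. ?l s * f (snd (snd s)))"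
  proof -
    have "(LINT x|distr L Sh Nmap. f (x 0)) = (LINT t|L. f (Nmap t 0))"
      by (intro integral_distr N) measurable
    also have "\<dots> = (LINT t|L. f (snd (snd (tri t 0))))" by (simp add: tri_def)
    also have "\<dots> = (\<Sum>s\<in>UNIV. ?l s * f (snd (snd s)))"
      by (rule L.expectation_finite_state[where g="\<lambda>s. f (snd (snd s))", OF L.measurable_state])
    finally show ?thesis .
  qed
  have sets: "{y. y} = {True}" "{y. \<not> y} = {False}" "{y. y \<longrightarrow> False} = {False}" by auto
  have ch: "channel ?p (False, True, False) = ?p" "channel ?p (False, True, True) = 1 - ?p"
    "channel ?p (a, a, a) = 1" for a
    using p01 by (auto simp: channel_def measure_pmf_single sets measure_pmf.prob_space)
  have logs: "log 2 ?p = f False - log 2 S" "log 2 (1 - ?p) = f True - log 2 S"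
    unfolding q using S by (simp_all add: log_divide_pos)
  have U: "(UNIV :: (bool \<times> bool \<times> bool) set) = {False, True} \<times> {False, True} \<times> {False, True}"
    by auto
  show ?thesis
    unfolding cross_entropy_def[OF inv] int rho U sum.cartesian_product[symmetric]
    using zero[of True] zero[of False] tf[of True] tf[of False]
    by (simp add: ch logs algebra_simps)
qed

end

section \<open>Entropy of the factor and rigidity in the equality case\<close>

lemma ent_factor_limits:
  assumes L: "L \<in> inv_meas3"
  shows "(\<lambda>n. shannon L (block Nmap 0 n) / n) \<longlonglongrightarrow> ent (distr L Sh Nmap)"
proof -
  interpret \<mu>: stationary_process "distr L Sh Nmap" "\<lambda>x. x"
    by (rule stationary_inv_meas[OF distr_inv_meas[OF L]])
  interpret L: stationary_process L tri by (rule stationary_inv_meas3[OF L])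
  interpret N: process L "\<lambda>t i. snd (snd (tri t i))" by (rule L.process_comp)
  have setsL: "sets L = sets Sh3" using L by (simp add: inv_meas3_def)
  have N: "Nmap \<in> measurable L Sh" by (simp add: measurable_cong_sets[OF setsL refl])
  have "block_entropy (distr L Sh Nmap) (\<lambda>x. x) n = shannon L (block Nmap 0 n)" for n
  proof -
    have s: "simple_function Sh (block (\<lambda>x. x) 0 n)"
      using \<mu>.simple_block[of 0 n] by (simp add: simple_function_def)
    have "\<mu>.law (block (\<lambda>x. x) 0 n) u = L.law (block Nmap 0 n) u" for u
      unfolding L.law_distr[OF N s] by (simp add: block_def[abs_def])
    moreover have "shannon L (block Nmap 0 n) = (\<Sum>u\<in>words n. - L.law (block Nmap 0 n) u * log 2 (L.law (block Nmap 0 n) u))"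
      using N.shannon_block_eq[of 0 n] by (simp add: tri_def)
    ultimately show ?thesis
      unfolding \<mu>.block_entropy_eq \<mu>.shannon_block_eq by simp
  qed
  then show ?thesis
    using \<mu>.ks_entropy_limit by (simp add: ent_def)
qed

context
  fixes \<rho> :: "(cfg \<times> cfg) measure"
  assumes inv: "\<rho> \<in> inv_meas2"
begin

interpretation \<rho>: stationary_process \<rho> pair_state
  by (rule stationary_inv_meas2[OF inv])

text \<open>\<open>H(z) \<le> H(w,x,z)\<close>, and the latter is the conditional entropy plus
  \<open>H(w,x)\<close>, which is \<open>o(n)\<close> by \<open>ent0\<close>. Since the conditional
  entropy at length \<open>k * m\<close> is at most \<open>k\<close> times that at \<open>m\<close>,
  every fixed \<open>m\<close> yields a bound, not only the limit.\<close>

lemma ent_factor_le: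
  assumes L: "L \<in> inv_meas3" "distr L Sh2 fst = \<rho>" and ent0: "ent2 \<rho> = 0"
    and m: "m > 0"
  shows "ent (distr L Sh Nmap) \<le> process.cond_entropy L tri base_state 0 m / m"
proof -
  interpret L: stationary_process L tri by (rule stationary_inv_meas3[OF L(1)])
  interpret b: process L "\<lambda>t i. base_state (tri t i)" by (rule L.process_comp)
  have base: "shannon L (block (\<lambda>t i. base_state (tri t i)) 0 n) = block_entropy \<rho> pair_state n" for n
    unfolding b.shannon_block_eq law_base_block[OF inv L] \<rho>.block_entropy_eq \<rho>.shannon_block_eq ..
  \<comment> \<open>Both limits are known to exist, so they may be taken along the multiples of
    \<open>m\<close>.\<close>
  have mono: "strict_mono (\<lambda>k. k * m)" using m by (simp add: strict_mono_def)
  have "(\<lambda>k. L.cond_entropy base_state 0 m / m + block_entropy \<rho> pair_state (k * m) / real (k * m))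
      \<longlonglongrightarrow> L.cond_entropy base_state 0 m / m + 0"
    using LIMSEQ_subseq_LIMSEQ[OF \<rho>.ks_entropy_limit mono] ent0
    by (intro tendsto_add tendsto_const) (simp add: comp_def ent2_def pair_state_def)
  moreover have "(\<lambda>k. shannon L (block Nmap 0 (k * m)) / real (k * m)) \<longlonglongrightarrow> ent (distr L Sh Nmap)"
    using LIMSEQ_subseq_LIMSEQ[OF ent_factor_limits[OF L(1)] mono] by (simp add: comp_def)
  moreover have "shannon L (block Nmap 0 (k * m)) / real (k * m)
      \<le> L.cond_entropy base_state 0 m / m + block_entropy \<rho> pair_state (k * m) / real (k * m)" if "k > 0" for k
  proof -
    have "shannon L (block Nmap 0 (k * m)) \<le> shannon L (block tri 0 (k * m))"
      using L.shannon_comp_le[OF L.simple_block, of "map (\<lambda>s. snd (snd s))"]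
      by (simp add: map_block tri_def)
    also have "\<dots> = L.cond_entropy base_state 0 (k * m) + block_entropy \<rho> pair_state (k * m)"
      by (simp add: L.cond_entropy_def base)
    also have "\<dots> \<le> k * L.cond_entropy base_state 0 m + block_entropy \<rho> pair_state (k * m)"
      using L.cond_entropy_mult by simp
    finally have "shannon L (block Nmap 0 (k * m)) / real (k * m)
        \<le> (k * L.cond_entropy base_state 0 m + block_entropy \<rho> pair_state (k * m)) / real (k * m)"
      by (intro divide_right_mono) auto
    then show ?thesis using that by (simp add: add_divide_distrib)
  qed
  ultimately show ?thesis
    by (intro LIMSEQ_le[where X="\<lambda>k. shannon L (block Nmap 0 (k * m)) / real (k * m)"])
      (auto intro!: exI[of _ 1])
qed

text \<open>Here the conditional entropy equals \<open>n * cross_entropy\<close> exactly, and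
  \<open>H(w,x,z) \<le> H(w,x) + H(z)\<close> hands it on to \<open>z\<close>.\<close>

lemma ent_product_ge:
  assumes p: "0 < p" "p < 1"
  shows "cross_entropy p (\<rho> \<Otimes>\<^sub>M bernoulli_shift p) \<le> ent (distr (\<rho> \<Otimes>\<^sub>M bernoulli_shift p) Sh Nmap)"
proof -
  let ?L = "\<rho> \<Otimes>\<^sub>M bernoulli_shift p"
  note L = product_inv_meas3[OF inv, of p]
  interpret L: stationary_process ?L tri by (rule stationary_inv_meas3[OF L(1)])
  interpret b: process ?L "\<lambda>t i. base_state (tri t i)" by (rule L.process_comp)
  interpret N: process ?L "\<lambda>t i. snd (snd (tri t i))" by (rule L.process_comp)
  have "cross_entropy p ?L \<le> shannon ?L (block Nmap 0 n) / n" if "n > 0" for n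
  proof -
    let ?A = "block (\<lambda>t i. base_state (tri t i)) 0 n" and ?Z = "block (\<lambda>t i. snd (snd (tri t i))) 0 n"
    have "shannon ?L (block tri 0 n) = shannon ?L (\<lambda>t. (?A t, ?Z t))"
    proof (rule L.shannon_bij)
      show "block tri 0 n t = (\<lambda>(a, z). map2 (\<lambda>a z. (fst a, snd a, z)) a z) (?A t, ?Z t)" for t
        by (auto simp: list_eq_iff_nth_eq base_state_def)
      show "(?A t, ?Z t) = (\<lambda>u. (map base_state u, map (\<lambda>s. snd (snd s)) u)) (block tri 0 n t)" for t
        by (simp add: map_block)
    qed (auto intro!: simple_function_Pair)
    also have "\<dots> \<le> shannon ?L ?A + shannon ?L ?Z"
      by (intro L.shannon_subadditive) auto
    finally have "L.cond_entropy base_state 0 n \<le> shannon ?L ?Z"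
      by (simp add: L.cond_entropy_def)
    then have "n * cross_entropy p ?L \<le> shannon ?L (block Nmap 0 n)"
      using joining_gibbs(3)[OF inv L p refl, of n] by (simp add: tri_def)
    then show ?thesis using that by (simp add: field_simps)
  qed
  then show ?thesis
    by (intro LIMSEQ_le_const[OF ent_factor_limits[OF L(1)]]) (auto intro!: exI[of _ 1])
qed

text \<open>\<open>ent_factor_le\<close> with \<open>m = n\<close> puts every single
  \<open>n\<close> in the equality case of Gibbs' inequality, so all block laws of
  \<open>(w,x,z)\<close> agree with those of the product; forgetting \<open>(w,x)\<close> leaves the
  law of \<open>z\<close>. The conclusion concerns images only, as \<open>y\<close> stays free where
  \<open>w = x\<close>.\<close>

lemma joining_entropy_eqD:
  assumes L: "L \<in> inv_meas3" "distr L Sh2 fst = \<rho>" and ent0: "ent2 \<rho> = 0"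
    and p: "0 < p" "p < 1" and eq: "ent (distr L Sh Nmap) = cross_entropy p L"
  shows "distr L Sh Nmap = distr (\<rho> \<Otimes>\<^sub>M bernoulli_shift p) Sh Nmap"
proof (rule inv_meas_eqI)
  let ?P = "\<rho> \<Otimes>\<^sub>M bernoulli_shift p"
  note P = product_inv_meas3[OF inv, of p]
  show 1: "distr L Sh Nmap \<in> inv_meas" "distr ?P Sh Nmap \<in> inv_meas"
    using L P by (auto intro: distr_inv_meas)
  interpret L: stationary_process L tri by (rule stationary_inv_meas3[OF L(1)])
  interpret P: stationary_process ?P tri by (rule stationary_inv_meas3[OF P(1)])
  interpret \<mu>: stationary_process "distr L Sh Nmap" "\<lambda>x. x"
    by (rule stationary_inv_meas[OF 1(1)])
  fix n and u :: "bool list"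
  have "L.cond_entropy base_state 0 n = n * cross_entropy p L"
  proof (cases "n = 0")
    case True
    then show ?thesis by (simp add: L.cond_entropy_def block_0 L.shannon_const)
  next
    case False
    then have "n * cross_entropy p L \<le> L.cond_entropy base_state 0 n"
      using ent_factor_le[OF L ent0, of n] eq by (simp add: field_simps)
    then show ?thesis using joining_gibbs(1)[OF inv L p, of n] by simp
  qed
  then have e: "L.law (block tri 0 n) v = P.law (block tri 0 n) v" for v
    by (rule joining_gibbs(2)[OF inv L p])
  have s: "simple_function Sh (block (\<lambda>x. x) 0 n)"
    using \<mu>.simple_block[of 0 n] by (simp add: simple_function_def)
  have N: "Nmap \<in> measurable M Sh" if "M \<in> inv_meas3" for M
  proof -
    have "sets M = sets Sh3" using that by (simp add: inv_meas3_def)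
    then show ?thesis using measurable_Nmap by (simp add: measurable_cong_sets[OF \<open>sets M = sets Sh3\<close> refl])
  qed
  have b: "block (\<lambda>x. x) 0 n (Nmap t) = map (\<lambda>s. snd (snd s)) (block tri 0 n t)" for t
    by (simp add: map_block tri_def) (simp add: block_def)
  show "prob_space.law (distr L Sh Nmap) (block (\<lambda>x. x) 0 n) u
      = prob_space.law (distr ?P Sh Nmap) (block (\<lambda>x. x) 0 n) u"
    unfolding L.law_distr[OF N[OF L(1)] s] P.law_distr[OF N[OF P(1)] s] b
    using L.law_comp[of "block tri 0 n" "words n" "map (\<lambda>s. snd (snd s))" u]
      P.law_comp[of "block tri 0 n" "words n" "map (\<lambda>s. snd (snd s))" u] e
    by (simp add: image_subset_iff)
qed

end

section \<open>Sequential compactness of the measures on the full shift\<close>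

text \<open>Tychonoff for the cube; a countable index type makes the product first countable, so
  compactness provides convergent subsequences.\<close>

lemma pointwise_convergent_subsequence:
  fixes g :: "nat \<Rightarrow> 'i::countable \<Rightarrow> real"
  assumes "\<And>n i. g n i \<in> {0..1}"
  obtains l r where "strict_mono (r :: nat \<Rightarrow> nat)" "\<And>i. (\<lambda>k. g (r k) i) \<longlonglongrightarrow> l i"
proof -
  have "compactin (product_topology (\<lambda>_::'i. euclidean) UNIV) (Pi\<^sub>E UNIV (\<lambda>_. {0..1::real}))"
    by (subst compactin_PiE) simp
  then have "compact (Pi\<^sub>E (UNIV::'i set) (\<lambda>_. {0..1::real}))"
    by (simp add: euclidean_product_topology)
  then have "seq_compact (Pi\<^sub>E (UNIV::'i set) (\<lambda>_. {0..1::real}))"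
    by (rule compact_imp_seq_compact)
  then obtain l r where r: "strict_mono (r :: nat \<Rightarrow> nat)" and l: "(g \<circ> r) \<longlonglongrightarrow> l"
    using assms unfolding seq_compact_def by (metis PiE_UNIV_domain Pi_I)
  have "(\<lambda>k. g (r k) i) \<longlonglongrightarrow> l i" for i
    using continuous_on_tendsto_compose[OF continuous_on_product_coordinates[of i] l]
    by (simp add: comp_def)
  then show ?thesis using r that by blast
qed

text \<open>The projective limit in \<open>cylinder_compactness\<close> is formed over the Polish
  space \<open>bool discrete\<close>; \<open>of_discrete\<close> returns to plain letters.\<close>

lemma measurable_of_discrete [measurable]:
  "(of_discrete :: 'a discrete \<Rightarrow> 'a) \<in> measurable borel (count_space UNIV)"
  by (auto intro!: measurableI borel_open open_discrete)

lemma of_discrete_eq_iff: "of_discrete x = b \<longleftrightarrow> x = discrete b"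
  by (metis UNIV_I discrete_inverse of_discrete_inverse)

lemma cylinder_refine:
  assumes "J \<subseteq> H" and u: "u \<in> Pi\<^sub>E J (\<lambda>_. UNIV)"
  shows "{v \<in> Pi\<^sub>E H (\<lambda>_. UNIV). restrict v J = u} = Pi\<^sub>E H (\<lambda>i. if i \<in> J then {u i} else UNIV)"
    and "cylinder J u = {x. \<forall>i\<in>H. x i \<in> (if i \<in> J then {u i} else UNIV)}"
proof -
  show "cylinder J u = {x. \<forall>i\<in>H. x i \<in> (if i \<in> J then {u i} else UNIV)}"
    using assms(1) by (auto simp: cylinder_def)
  have "restrict v J = u \<longleftrightarrow> (\<forall>i\<in>J. v i = u i)" for v
    using u by (auto simp: fun_eq_iff restrict_def PiE_def extensional_def)
  then show "{v \<in> Pi\<^sub>E H (\<lambda>_. UNIV). restrict v J = u} = Pi\<^sub>E H (\<lambda>i. if i \<in> J then {u i} else UNIV)"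
    using assms(1) by (auto simp: PiE_iff extensional_def split: if_splits)
qed

text \<open>Weak compactness in elementary form: all cylinder probabilities converge along one
  subsequence, the limits stay consistent under refinement, and Kolmogorov's extension theorem
  realizes them by a measure.\<close>

theorem cylinder_compactness:
  fixes Q :: "nat \<Rightarrow> cfg measure"
  assumes Q: "\<And>n. sets (Q n) = sets Sh" "\<And>n. prob_space (Q n)"
  obtains r \<mu> where "strict_mono (r :: nat \<Rightarrow> nat)" "sets \<mu> = sets Sh" "prob_space \<mu>"
    "\<And>J u. finite J \<Longrightarrow> (\<lambda>k. measure (Q (r k)) (cylinder J u)) \<longlonglongrightarrow> measure \<mu> (cylinder J u)"
proof -
  interpret Q: prob_space "Q n" for n by (rule Q)
  \<comment> \<open>Finite lists of pairs (coordinate, letter) form a countable type that names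
    every cylinder, unlike pairs of a set and a configuration.\<close>
  obtain l and r :: "nat \<Rightarrow> nat" where r: "strict_mono r"
    and l: "\<And>w :: (int \<times> bool) list. (\<lambda>k. measure (Q (r k)) {x. \<forall>(i, b)\<in>set w. x i = b}) \<longlonglongrightarrow> l w"
    by (rule pointwise_convergent_subsequence[of "\<lambda>n w. measure (Q n) {x. \<forall>(i, b)\<in>set w. x i = b}"]) auto
  \<comment> \<open>The sorted list selects one name for the pattern and reads \<open>u\<close> only
    on \<open>J\<close>, so \<open>c J\<close> ignores the values of \<open>u\<close>
    elsewhere.\<close>
  define c where "c J u = l (map (\<lambda>i. (i, u i)) (sorted_list_of_set J))" for J and u :: cfg
  have c: "(\<lambda>k. measure (Q (r k)) (cylinder J u)) \<longlonglongrightarrow> c J u" if "finite J" for J u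
  proof -
    have "{x. \<forall>(i, b)\<in>set (map (\<lambda>i. (i, u i)) (sorted_list_of_set J)). x i = b} = cylinder J u"
      using that by (auto simp: cylinder_def)
    then show ?thesis unfolding c_def using l[of "map (\<lambda>i. (i, u i)) (sorted_list_of_set J)"] by simp
  qed
  have c_nonneg: "0 \<le> c J u" if "finite J" for J u
    using c[OF that] by (rule LIMSEQ_le_const) auto
  have meas_box: "measure (Q n) {x. \<forall>i\<in>J. x i \<in> A i} = (\<Sum>u\<in>Pi\<^sub>E J A. measure (Q n) (cylinder J u))"
    if "finite J" for n J and A :: "int \<Rightarrow> bool set"
    unfolding box_decomposition(1)[OF that]
    using that box_decomposition(2,3)[OF that, of A] Q(1)
    by (intro Q.finite_measure_finite_Union) auto
  have c_total: "(\<Sum>u\<in>Pi\<^sub>E J (\<lambda>_. UNIV). c J u) = 1" if J: "finite J" for J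
  proof (rule LIMSEQ_unique)
    show "(\<lambda>k. \<Sum>u\<in>Pi\<^sub>E J (\<lambda>_. UNIV). measure (Q (r k)) (cylinder J u)) \<longlonglongrightarrow> (\<Sum>u\<in>Pi\<^sub>E J (\<lambda>_. UNIV). c J u)"
      by (intro tendsto_sum c J)
    have "measure (Q n) UNIV = 1" for n
      using Q.prob_space[of n] sets_eq_imp_space_eq[OF Q(1)] by simp
    then show "(\<lambda>k. \<Sum>u\<in>Pi\<^sub>E J (\<lambda>_. UNIV). measure (Q (r k)) (cylinder J u)) \<longlonglongrightarrow> 1"
      unfolding meas_box[OF J, symmetric] by simp
  qed
  have c_refine: "(\<Sum>v\<in>{v \<in> Pi\<^sub>E H (\<lambda>_. UNIV). restrict v J = u}. c H v) = c J u"
    if JH: "J \<subseteq> H" and H: "finite H" and u: "u \<in> Pi\<^sub>E J (\<lambda>_. UNIV)" for J H u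
  proof (rule LIMSEQ_unique)
    have J: "finite J" using JH H by (rule finite_subset)
    let ?V = "{v \<in> Pi\<^sub>E H (\<lambda>_. UNIV). restrict v J = u}"
    show "(\<lambda>k. \<Sum>v\<in>?V. measure (Q (r k)) (cylinder H v)) \<longlonglongrightarrow> (\<Sum>v\<in>?V. c H v)"
      by (intro tendsto_sum c H)
    show "(\<lambda>k. \<Sum>v\<in>?V. measure (Q (r k)) (cylinder H v)) \<longlonglongrightarrow> c J u"
      unfolding cylinder_refine(1)[OF JH u] meas_box[OF H, symmetric] cylinder_refine(2)[OF JH u, symmetric]
      by (rule c[OF J])
  qed
  \<comment> \<open>Mass 0 off the extensional functions makes \<open>p J\<close> live on the
    finitely many patterns over \<open>J\<close>.\<close>
  define p where "p J = embed_pmf (\<lambda>u. if u \<in> Pi\<^sub>E J (\<lambda>_. UNIV) then c J u else 0)" for J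
  have pmf_p: "pmf (p J) u = (if u \<in> Pi\<^sub>E J (\<lambda>_. UNIV) then c J u else 0)" if J: "finite J" for J u
    unfolding p_def
  proof (rule pmf_embed_pmf)
    have fin: "finite (Pi\<^sub>E J (\<lambda>_. UNIV :: bool set))" by (rule box_decomposition(3)[OF J])
    have "(\<integral>\<^sup>+ u. ennreal (if u \<in> Pi\<^sub>E J (\<lambda>_. UNIV) then c J u else 0) \<partial>count_space UNIV)
        = (\<Sum>u\<in>Pi\<^sub>E J (\<lambda>_. UNIV). ennreal (if u \<in> Pi\<^sub>E J (\<lambda>_. UNIV) then c J u else 0))"
      by (rule nn_integral_count_space'[OF fin]) auto
    also have "\<dots> = ennreal (\<Sum>u\<in>Pi\<^sub>E J (\<lambda>_. UNIV). c J u)"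
      using c_nonneg[OF J] by (simp add: sum_ennreal)
    finally show "(\<integral>\<^sup>+ u. ennreal (if u \<in> Pi\<^sub>E J (\<lambda>_. UNIV) then c J u else 0) \<partial>count_space UNIV) = 1"
      by (simp add: c_total[OF J])
  qed (use c_nonneg[OF J] in auto)
  have measure_p: "measure (measure_pmf (p J)) E = (\<Sum>u\<in>{u \<in> Pi\<^sub>E J (\<lambda>_. UNIV). u \<in> E}. c J u)"
    if J: "finite J" for J E
  proof -
    have fin: "finite (Pi\<^sub>E J (\<lambda>_. UNIV :: bool set))" by (rule box_decomposition(3)[OF J])
    have "measure (measure_pmf (p J)) E = measure (measure_pmf (p J)) (E \<inter> set_pmf (p J))"
      by (rule measure_Int_set_pmf[symmetric])
    also have "E \<inter> set_pmf (p J) = {u \<in> Pi\<^sub>E J (\<lambda>_. UNIV). u \<in> E} \<inter> set_pmf (p J)"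
      by (auto simp: set_pmf_eq pmf_p[OF J] split: if_splits)
    also have "measure (measure_pmf (p J)) \<dots> = measure (measure_pmf (p J)) {u \<in> Pi\<^sub>E J (\<lambda>_. UNIV). u \<in> E}"
      by (rule measure_Int_set_pmf)
    also have "\<dots> = (\<Sum>u\<in>{u \<in> Pi\<^sub>E J (\<lambda>_. UNIV). u \<in> E}. pmf (p J) u)"
      using fin by (intro measure_measure_pmf_finite) auto
    also have "\<dots> = (\<Sum>u\<in>{u \<in> Pi\<^sub>E J (\<lambda>_. UNIV). u \<in> E}. c J u)"
      by (intro sum.cong) (auto simp: pmf_p[OF J])
    finally show ?thesis .
  qed
  have p_restrict: "map_pmf (\<lambda>v. restrict v J) (p H) = p J" if JH: "J \<subseteq> H" and H: "finite H" for J H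
  proof (rule pmf_eqI)
    fix u
    have J: "finite J" using JH H by (rule finite_subset)
    have "pmf (map_pmf (\<lambda>v. restrict v J) (p H)) u = (\<Sum>v\<in>{v \<in> Pi\<^sub>E H (\<lambda>_. UNIV). restrict v J = u}. c H v)"
      unfolding pmf_map measure_p[OF H] by (simp add: vimage_def)
    also have "\<dots> = pmf (p J) u"
    proof (cases "u \<in> Pi\<^sub>E J (\<lambda>_. UNIV)")
      case False
      then have e: "{v \<in> Pi\<^sub>E H (\<lambda>_. UNIV). restrict v J = u} = {}" by auto
      show ?thesis unfolding e using False by (simp add: pmf_p[OF J])
    qed (simp add: c_refine[OF JH H] pmf_p[OF J])
    finally show "pmf (map_pmf (\<lambda>v. restrict v J) (p H)) u = pmf (p J) u" .
  qed
  define D :: "int set \<Rightarrow> cfg \<Rightarrow> int \<Rightarrow> bool discrete" where "D J u = (\<lambda>i\<in>J. discrete (u i))" for J u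
  define P where "P J = distr (measure_pmf (p J)) (PiM J (\<lambda>_. borel)) (D J)" for J
  have D: "D J \<in> measurable (measure_pmf q) (PiM J (\<lambda>_. borel))" for J q
    by (auto simp: D_def space_PiM)
  interpret P: polish_projective UNIV P
  proof (intro polish_projective.intro projective_family.intro)
    show "P J = distr (P H) (PiM J (\<lambda>_. borel)) (\<lambda>f. restrict f J)"
      if JH: "J \<subseteq> H" and H: "finite H" for J H
    proof -
      have "distr (P H) (PiM J (\<lambda>_. borel)) (\<lambda>f. restrict f J)
          = distr (measure_pmf (p H)) (PiM J (\<lambda>_. borel)) ((\<lambda>f. restrict f J) \<circ> D H)"
        unfolding P_def using JH by (intro distr_distr measurable_restrict_subset D)
      also have "(\<lambda>f. restrict f J) \<circ> D H = D J \<circ> (\<lambda>v. restrict v J)"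
        using JH by (auto simp: D_def fun_eq_iff)
      also have "distr (measure_pmf (p H)) (PiM J (\<lambda>_. borel)) \<dots>
          = distr (distr (measure_pmf (p H)) (count_space UNIV) (\<lambda>v. restrict v J)) (PiM J (\<lambda>_. borel)) (D J)"
        by (intro distr_distr[symmetric]) (auto simp: D_def space_PiM)
      also have "distr (measure_pmf (p H)) (count_space UNIV) (\<lambda>v. restrict v J) = measure_pmf (p J)"
        using p_restrict[OF JH H] by (simp add: map_pmf_rep_eq[symmetric])
      finally show ?thesis by (simp only: P_def[of J])
    qed
    show "prob_space (P J)" for J
      unfolding P_def by (intro prob_space.prob_space_distr prob_space_measure_pmf D)
  qed
  define \<mu> where "\<mu> = distr P.lim Sh (\<lambda>x i. of_discrete (x i))"
  have m: "(\<lambda>x i. of_discrete (x i)) \<in> measurable P.lim Sh"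
    by (intro measurable_ShI) (simp add: measurable_cong_sets[OF P.sets_lim refl])
  have "measure \<mu> (cylinder J u) = c J u" if J: "finite J" for J u
  proof -
    let ?E = "Pi\<^sub>E J (\<lambda>i. {discrete (u i)})"
    have E: "?E \<in> sets (PiM J (\<lambda>_. borel))"
      using J by (intro sets_PiM_I_finite) (auto intro: borel_closed)
    have "measure \<mu> (cylinder J u) = measure P.lim ((\<lambda>x i. of_discrete (x i)) -` cylinder J u \<inter> space P.lim)"
      unfolding \<mu>_def using J m by (intro measure_distr) auto
    also have "(\<lambda>x i. of_discrete (x i)) -` cylinder J u \<inter> space P.lim = prod_emb UNIV (\<lambda>_. borel) J ?E"
      by (auto simp: cylinder_def prod_emb_def space_PiM PiE_iff P.space_lim of_discrete_eq_iff)
    also have "measure P.lim \<dots> = measure (P J) ?E"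
      using J E by (intro P.measure_lim_emb) auto
    also have "\<dots> = measure (measure_pmf (p J)) (D J -` ?E \<inter> space (measure_pmf (p J)))"
      unfolding P_def by (intro measure_distr D E)
    also have "\<dots> = (\<Sum>v\<in>{v \<in> Pi\<^sub>E J (\<lambda>_. UNIV). v \<in> D J -` ?E \<inter> space (measure_pmf (p J))}. c J v)"
      by (rule measure_p[OF J])
    also have "{v \<in> Pi\<^sub>E J (\<lambda>_. UNIV). v \<in> D J -` ?E \<inter> space (measure_pmf (p J))} = {restrict u J}"
      by (auto simp: D_def PiE_iff discrete_inject extensional_def fun_eq_iff)
    also have "(\<Sum>v\<in>{restrict u J}. c J v) = c J (restrict u J)" by (subst sum.insert) auto
    finally have "measure \<mu> (cylinder J u) = c J (restrict u J)" .
    also have "\<dots> = c J u"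
      unfolding c_def using J by (intro arg_cong[where f=l] map_cong) auto
    finally show ?thesis .
  qed
  then show ?thesis
    using c m by (intro that[OF r, of \<mu>]) (auto simp: \<mu>_def intro!: P.P.prob_space_distr)
qed

section \<open>The variational principle for potentials depending on one coordinate\<close>

text \<open>For each offset \<open>j < m\<close> the block is covered by a head of length
  \<open>j\<close>, then \<open>q\<close> windows of length \<open>m\<close>, then a tail; head and
  tail each cost at most \<open>m * log 2 CARD('a)\<close>. Summing over the offsets uses all window
  positions evenly, which takes the place of stationarity.\<close>

lemma (in process) shannon_windows:
  assumes m: "m > 0"
  shows "m * shannon M (block c 0 n) \<le> (\<Sum>i<n. shannon M (block c (int i) m)) + 2 * real m * real m * log 2 CARD('a)"
proof -
  define G where "G i l = shannon M (block c (int i) l)" for i l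
  have sub: "G i (k + l) \<le> G i k + G (i + k) l" for i k l
    using shannon_block_subadditive[of "int i" k l] by (simp add: G_def)
  have mono: "k \<le> l \<Longrightarrow> G i k \<le> G i l" for i k l
    unfolding G_def by (rule shannon_block_mono)
  have ub: "l \<le> m \<Longrightarrow> G i l \<le> m * log 2 CARD('a)" for i l
    using order_trans[OF mono[of l m i] shannon_block_le[of "int i" m, folded G_def]] .
  have nn: "0 \<le> G i l" for i l unfolding G_def by (rule shannon_nonneg) simp
  define q where "q = n div m"
  have qm: "q * m \<le> n" "n \<le> q * m + m"
    using m mod_less_divisor[OF m, of n] div_mult_mod_eq[of n m] unfolding q_def by linarith+
  have tile: "G j (k * m) \<le> (\<Sum>t<k. G (j + t * m) m)" for j k
  proof (induction k)
    case 0
    then show ?case by (simp add: G_def block_0 shannon_const)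
  next
    case (Suc k)
    then show ?case using sub[of j "k * m" m] by (simp add: add.commute)
  qed
  have "G 0 n \<le> (\<Sum>t<q. G (j + t * m) m) + 2 * (m * log 2 CARD('a))" if "j < m" for j
  proof -
    \<comment> \<open>Monotonicity permits the covering to overshoot the end of the block.\<close>
    have "G 0 n \<le> G 0 (j + (q * m + m))" using qm by (intro mono) simp
    also have "\<dots> \<le> G 0 j + (G j (q * m) + G (j + q * m) m)"
      using sub[of 0 j "q * m + m"] sub[of j "q * m" m] by simp
    finally show ?thesis using tile[of j q] ub[of j 0] ub[of m "j + q * m"] that by simp
  qed
  then have "(\<Sum>j<m. G 0 n) \<le> (\<Sum>j<m. (\<Sum>t<q. G (j + t * m) m) + 2 * (m * log 2 CARD('a)))"
    by (intro sum_mono) auto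
  also have "\<dots> = (\<Sum>t<q. \<Sum>j<m. G (j + t * m) m) + 2 * real m * real m * log 2 CARD('a)"
    by (simp add: sum.distrib sum.swap[of _ "{..<m}"])
  \<comment> \<open>The starts \<open>j + t * m\<close> run through the integers below
    \<open>q * m\<close> exactly once.\<close>
  also have "(\<Sum>t<q. \<Sum>j<m. G (j + t * m) m) = (\<Sum>i<q * m. G i m)"
    unfolding sum.nat_group[symmetric]
  proof (rule sum.cong[OF refl])
    fix t
    show "(\<Sum>j<m. G (j + t * m) m) = sum (\<lambda>i. G i m) {t * m..<t * m + m}"
      using sum.shift_bounds_nat_ivl[of "\<lambda>i. G i m" 0 "t * m" m]
      by (simp add: lessThan_atLeast0 add.commute)
  qed
  also have "\<dots> \<le> (\<Sum>i<n. G i m)"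
    using qm nn by (intro sum_mono2) auto
  finally show ?thesis by (simp add: G_def)
qed

section \<open>Words, weights and empirical measures\<close>

definition weight :: "(bool \<Rightarrow> real) \<Rightarrow> bool list \<Rightarrow> real" where
  "weight f u = (\<Sum>j<length u. f (u ! j))"

definition partition_sum :: "cfg set \<Rightarrow> (bool \<Rightarrow> real) \<Rightarrow> nat \<Rightarrow> real" where
  "partition_sum X f n = (\<Sum>u\<in>lang X n. 2 powr weight f u)"

lemma funpow_shift: "(shift ^^ j) x = (\<lambda>i. x (i + int j))"
  by (induction j) (auto simp: shift_def fun_eq_iff algebra_simps)

text \<open>The Birkhoff sum reads only the coordinates fixed by the cylinder, so the supremum is
  over a constant.\<close>

lemma pressure_eq:
  "pressure X (\<lambda>x. f (x 0)) = lim (\<lambda>n. log 2 (partition_sum X f n) / n)"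
proof -
  have "(SUP x\<in>cyl X u. \<Sum>j<n. f ((shift ^^ j) x 0)) = weight f u" if "u \<in> lang X n" for n u
  proof -
    have u: "length u = n" "cyl X u \<noteq> {}" using that by (auto simp: lang_def)
    have "(\<Sum>j<n. f ((shift ^^ j) x 0)) = weight f u" if "x \<in> cyl X u" for x
      using that u(1) by (auto simp: weight_def funpow_shift cyl_def intro!: sum.cong)
    then show ?thesis using u(2) by simp
  qed
  then show ?thesis by (simp add: pressure_def partition_sum_def)
qed

lemma lang_subset_words: "lang X n \<subseteq> words n"
  by (auto simp: lang_def words_def)

lemma finite_lang [simp]: "finite (lang X n)"
  by (rule finite_subset[OF lang_subset_words finite_words])

lemma lang_eq: "lang X n = block (\<lambda>x. x) 0 n ` X"
proof -
  have "block (\<lambda>x. x) 0 n x = u \<longleftrightarrow> length u = n \<and> (\<forall>i<n. x (int i) = u ! i)" for x :: cfg and u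
    by (simp add: block_eq_iff)
  then have "cyl X u \<noteq> {} \<and> length u = n \<longleftrightarrow> (\<exists>x\<in>X. block (\<lambda>x. x) 0 n x = u)" for u
    by (auto simp: cyl_def)
  then show ?thesis unfolding lang_def image_def by (intro Collect_cong) metis
qed

lemma partition_sum_pos: "X \<noteq> {} \<Longrightarrow> 0 < partition_sum X f n"
  unfolding partition_sum_def by (intro sum_pos finite_lang) (auto simp: lang_eq)

lemma (in process) expected_weight:
  fixes f :: "'a \<Rightarrow> real"
  shows "(\<Sum>u\<in>words n. law (block c a n) u * (\<Sum>j<n. f (u ! j)))
    = (\<Sum>j<n. \<Sum>b\<in>UNIV. law (\<lambda>\<omega>. c \<omega> (a + int j)) b * f b)"
proof -
  have "(\<Sum>u\<in>words n. law (block c a n) u * (\<Sum>j<n. f (u ! j)))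
      = (\<Sum>j<n. \<Sum>u\<in>words n. law (block c a n) u * f (u ! j))"
    by (simp add: sum_distrib_left sum.swap[of _ "words n"])
  also have "\<dots> = (\<Sum>j<n. \<Sum>b\<in>UNIV. law (\<lambda>\<omega>. c \<omega> (a + int j)) b * f b)"
  proof (rule sum.cong[OF refl])
    fix j assume j: "j \<in> {..<n}"
    have "(\<Sum>u\<in>words n. law (block c a n) u * f (u ! j))
        = (\<Sum>b\<in>UNIV. law (\<lambda>\<omega>. block c a n \<omega> ! j) b * f b)"
      by (rule law_marginal[where h="\<lambda>u. u ! j"]) auto
    then show "(\<Sum>u\<in>words n. law (block c a n) u * f (u ! j)) = (\<Sum>b\<in>UNIV. law (\<lambda>\<omega>. c \<omega> (a + int j)) b * f b)"
      using j by simp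
  qed
  finally show ?thesis .
qed

lemma expectation_coord:
  assumes "sets \<mu> = sets Sh" "prob_space \<mu>"
  shows "(LINT x|\<mu>. f (x i)) = (\<Sum>b\<in>UNIV. prob_space.law \<mu> (\<lambda>x. x i) b * f b)"
proof -
  interpret process \<mu> "\<lambda>x. x" using assms by (rule process_cfg)
  show ?thesis by (rule expectation_finite_state[OF measurable_state])
qed

text \<open>The easy half of the variational principle at finite length: Gibbs' inequality against
  the probability proportional to \<open>2 powr weight f u\<close> on the language, which carries
  all blocks of \<mu>.\<close>

lemma block_entropy_le_partition_sum:
  assumes \<mu>: "\<mu> \<in> inv_meas_on X"
  shows "block_entropy \<mu> (\<lambda>x. x) n + n * (LINT x|\<mu>. f (x 0)) \<le> log 2 (partition_sum X f n)"
proof -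
  have \<mu>': "\<mu> \<in> inv_meas" "AE x in \<mu>. x \<in> X" using \<mu> by (auto simp: inv_meas_on_def)
  interpret \<mu>: stationary_process \<mu> "\<lambda>x. x" by (rule stationary_inv_meas[OF \<mu>'(1)])
  have s: "sets \<mu> = sets Sh" "prob_space \<mu>" using \<mu>' by (auto simp: inv_meas_def)
  have "X \<noteq> {}" using \<mu>.AE_contr \<mu>'(2) \<mu>.not_empty by (auto simp: \<mu>.AE_False)
  then have Z: "partition_sum X f n > 0" by (rule partition_sum_pos)
  let ?p = "\<mu>.law (block (\<lambda>x. x) 0 n)" and ?Z = "partition_sum X f n"
  have off: "?p u = 0" if "u \<notin> lang X n" for u
  proof -
    have ev: "block (\<lambda>x. x) 0 n -` {u} \<inter> space \<mu> \<in> \<mu>.events" by (rule simple_functionD) simp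
    have "AE x in \<mu>. x \<notin> block (\<lambda>x. x) 0 n -` {u} \<inter> space \<mu>"
      using \<mu>'(2) by eventually_elim (use that in \<open>auto simp: lang_eq\<close>)
    then show ?thesis unfolding \<mu>.law_def using ev by (simp add: \<mu>.prob_eq_0)
  qed
  have on: "(\<Sum>u\<in>words n. ?p u * g u) = (\<Sum>u\<in>lang X n. ?p u * g u)" for g
    using off by (intro sum.mono_neutral_right lang_subset_words) auto
  have tot: "sum ?p (lang X n) = 1"
    using on[of "\<lambda>_. 1"] \<mu>.sum_law[of "block (\<lambda>x. x) 0 n" "words n"] by (simp add: image_subset_iff)
  have "block_entropy \<mu> (\<lambda>x. x) n = (\<Sum>u\<in>lang X n. - ?p u * log 2 (?p u))"
    using on[of "\<lambda>u. - log 2 (?p u)"] by (simp add: \<mu>.block_entropy_eq \<mu>.shannon_block_eq)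
  also have "\<dots> \<le> (\<Sum>u\<in>lang X n. - ?p u * log 2 (2 powr weight f u / ?Z))"
    using Z tot by (intro gibbs(1)) (auto simp: partition_sum_def simp flip: sum_divide_distrib)
  also have "\<dots> = (\<Sum>u\<in>lang X n. ?p u * log 2 ?Z - ?p u * weight f u)"
    using Z by (intro sum.cong) (auto simp: log_divide_pos algebra_simps)
  also have "\<dots> = log 2 ?Z - (\<Sum>u\<in>lang X n. ?p u * weight f u)"
    by (simp add: sum_subtractf tot flip: sum_distrib_right)
  also have "(\<Sum>u\<in>lang X n. ?p u * weight f u) = (\<Sum>u\<in>words n. ?p u * (\<Sum>j<n. f (u ! j)))"
    unfolding on by (intro sum.cong) (auto simp: weight_def lang_def)
  also have "\<dots> = n * (LINT x|\<mu>. f (x 0))"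
    unfolding \<mu>.expected_weight expectation_coord[OF s] using \<mu>.law_state[of 0] by simp
  finally show ?thesis by simp
qed

text \<open>Misiurewicz' construction for a single \<open>n\<close>: Gibbs weights on the words, one
  point of \<open>X\<close> per word, averaged over the first \<open>n\<close> shifts. The errors in
  invariance and entropy are explicit in \<open>n\<close>, ready for a limit.\<close>

lemma empirical_measure:
  assumes X: "subshift X" "X \<noteq> {}" and n: "n > 0"
  obtains Q where "sets Q = sets Sh" "prob_space Q"
    "\<And>E. E \<in> sets Sh \<Longrightarrow> E \<inter> X = {} \<Longrightarrow> measure Q E = 0"
    "\<And>E. E \<in> sets Sh \<Longrightarrow> \<bar>measure Q (shift -` E) - measure Q E\<bar> \<le> 1 / n"
    "\<And>m. m > 0 \<Longrightarrow> log 2 (partition_sum X f n) / n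
      \<le> block_entropy Q (\<lambda>x. x) m / m + 2 * m / n + (LINT x|Q. f (x 0))"
proof -
  let ?Z = "partition_sum X f n" and ?w = "\<lambda>u. 2 powr weight f u"
  have Z: "?Z > 0" using X(2) by (rule partition_sum_pos)
  then have Z': "0 \<le> ?Z" by simp
  define p where "p = embed_pmf (\<lambda>u. if u \<in> lang X n then ?w u / ?Z else 0)"
  have pmf_p: "pmf p u = (if u \<in> lang X n then ?w u / ?Z else 0)" for u
    unfolding p_def
  proof (rule pmf_embed_pmf)
    have "(\<integral>\<^sup>+ u. ennreal (if u \<in> lang X n then ?w u / ?Z else 0) \<partial>count_space UNIV)
        = (\<Sum>u\<in>lang X n. ennreal (if u \<in> lang X n then ?w u / ?Z else 0))"
      by (rule nn_integral_count_space'[OF finite_lang]) auto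
    also have "\<dots> = ennreal (\<Sum>u\<in>lang X n. ?w u / ?Z)"
      using Z' by (simp add: sum_ennreal)
    also have "(\<Sum>u\<in>lang X n. ?w u / ?Z) = 1"
      using Z by (simp add: partition_sum_def flip: sum_divide_distrib)
    finally show "(\<integral>\<^sup>+ u. ennreal (if u \<in> lang X n then ?w u / ?Z else 0) \<partial>count_space UNIV) = 1"
      by simp
  qed (use Z' in auto)
  \<comment> \<open>\<open>c\<close> must be total: outside the language any point of
    \<open>X\<close> will do, since \<open>p\<close> gives such words no mass and all orbits stay in
    \<open>X\<close>.\<close>
  define c where "c u = (if u \<in> lang X n then (SOME x. x \<in> cyl X u) else (SOME x. x \<in> X))" for u
  have c_cyl: "c u \<in> cyl X u" if "u \<in> lang X n" for u
    using that by (auto simp: c_def lang_def some_in_eq)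
  have c_X: "c u \<in> X" for u
    using c_cyl[of u] X(2) by (cases "u \<in> lang X n") (auto simp: cyl_def c_def some_in_eq)
  have shift_X: "(shift ^^ i) (c u) \<in> X" for i u
    using X(1) c_X[of u] unfolding subshift_def by (induction i) auto
  interpret p: process "measure_pmf p" c
    by (intro processI prob_space_measure_pmf) simp
  \<comment> \<open>The average over shifts as a two-stage experiment: a uniform time, then a
    word.\<close>
  define q where "q = bind_pmf (pmf_of_set {..<n}) (\<lambda>i. map_pmf (\<lambda>u. (shift ^^ i) (c u)) p)"
  \<comment> \<open>A pmf measures all subsets; \<open>distr\<close> along the identity restricts it
    to the product \<sigma>-algebra.\<close>
  define Q where "Q = distr (measure_pmf q) Sh (\<lambda>x. x)"
  have Q: "sets Q = sets Sh" "prob_space Q"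
    unfolding Q_def by (auto intro!: prob_space.prob_space_distr prob_space_measure_pmf)
  interpret Q: process Q "\<lambda>x. x" using Q by (rule process_cfg)
  have measQ: "measure Q E = (\<Sum>i<n. measure (measure_pmf p) {u. (shift ^^ i) (c u) \<in> E}) / n"
    if E: "E \<in> sets Sh" for E
  proof -
    have "emeasure Q E = emeasure (measure_pmf q) E"
      unfolding Q_def using E by (subst emeasure_distr) auto
    also have "\<dots> = (\<integral>\<^sup>+ i. emeasure (measure_pmf (map_pmf (\<lambda>u. (shift ^^ i) (c u)) p)) E \<partial>measure_pmf (pmf_of_set {..<n}))"
      unfolding q_def by (rule emeasure_bind_pmf)
    also have "\<dots> = (\<Sum>i<n. emeasure (measure_pmf (map_pmf (\<lambda>u. (shift ^^ i) (c u)) p)) E) / n"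
      using n by (subst nn_integral_pmf_of_set) auto
    also have "\<dots> = (\<Sum>i<n. ennreal (measure (measure_pmf p) {u. (shift ^^ i) (c u) \<in> E})) / n"
      by (simp add: measure_pmf.emeasure_eq_measure vimage_def)
    also have "\<dots> = ennreal ((\<Sum>i<n. measure (measure_pmf p) {u. (shift ^^ i) (c u) \<in> E}) / n)"
      using n by (simp add: sum_ennreal ennreal_of_nat_eq_real_of_nat divide_ennreal sum_nonneg)
    finally show ?thesis
      by (simp add: Q.emeasure_eq_measure sum_nonneg)
  qed
  have "measure Q E = 0" if "E \<in> sets Sh" "E \<inter> X = {}" for E
  proof -
    have "{u. (shift ^^ i) (c u) \<in> E} = {}" for i using that(2) shift_X by auto
    then show ?thesis by (simp add: measQ[OF that(1)])
  qed
  moreover have "\<bar>measure Q (shift -` E) - measure Q E\<bar> \<le> 1 / n" if E: "E \<in> sets Sh" for E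
  proof -
    let ?a = "\<lambda>i. measure (measure_pmf p) {u. (shift ^^ i) (c u) \<in> E}"
    have E': "shift -` E \<in> sets Sh" using measurable_sets[OF measurable_shift E] by simp
    \<comment> \<open>Shifting the average changes it only by its first and last terms.\<close>
    have "measure Q (shift -` E) - measure Q E = (\<Sum>i<n. ?a (Suc i) - ?a i) / n"
      unfolding measQ[OF E] measQ[OF E'] by (simp add: sum_subtractf diff_divide_distrib)
    also have "\<dots> = (?a n - ?a 0) / n" by (simp only: sum_lessThan_telescope[of ?a n])
    finally have e: "measure Q (shift -` E) - measure Q E = (?a n - ?a 0) / n" .
    have "\<bar>?a n - ?a 0\<bar> \<le> 1"
      using measure_pmf.prob_le_1[of p "{u. (shift ^^ n) (c u) \<in> E}"]
        measure_pmf.prob_le_1[of p "{u. (shift ^^ 0) (c u) \<in> E}"]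
        measure_nonneg[of "measure_pmf p" "{u. (shift ^^ n) (c u) \<in> E}"]
        measure_nonneg[of "measure_pmf p" "{u. (shift ^^ 0) (c u) \<in> E}"] by linarith
    then show ?thesis unfolding e by (simp add: divide_right_mono)
  qed
  moreover have "log 2 ?Z / n \<le> block_entropy Q (\<lambda>x. x) m / m + 2 * m / n + (LINT x|Q. f (x 0))"
    if m: "m > 0" for m
  proof -
    have law_avg: "(\<Sum>i<n. measure_pmf.law p (\<lambda>u. V ((shift ^^ i) (c u))) v) = n * Q.law V v"
      if "simple_function Q V" for V :: "cfg \<Rightarrow> 'z" and v
    proof -
      have "V -` {v} \<inter> space Q \<in> sets Sh" using simple_functionD(2)[OF that] Q by simp
      from measQ[OF this] show ?thesis
        using n sets_eq_imp_space_eq[OF Q(1)] by (simp add: measure_pmf.law_def Q.law_def vimage_def)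
    qed
    have sh: "block (\<lambda>x. x) 0 m ((shift ^^ i) (c u)) = block c (int i) m u" for i u
      by (auto simp: block_def funpow_shift algebra_simps)
    let ?a = "\<lambda>i. measure_pmf.law p (block c (int i) m)" and ?b = "Q.law (block (\<lambda>x. x) 0 m)"
    have avg: "(\<Sum>i<n. ?a i v) = n * ?b v" for v
      using law_avg[of "block (\<lambda>x. x) 0 m" v] by (simp add: sh)
    \<comment> \<open>Concavity of entropy by way of Gibbs' inequality: each window law is compared
      with the averaged law, and these cross entropies add up to \<open>n\<close> times the entropy
      of the average.\<close>
    have "(\<Sum>i<n. shannon (measure_pmf p) (block c (int i) m)) \<le> (\<Sum>i<n. \<Sum>v\<in>words m. - ?a i v * log 2 (?b v))"
    proof (rule sum_mono)
      fix i assume i: "i \<in> {..<n}"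
      have pos: "?b v > 0" if "?a i v > 0" for v
      proof -
        have "?a i v \<le> (\<Sum>i<n. ?a i v)" using i by (intro member_le_sum) auto
        then have "0 < n * ?b v" using that avg[of v] by simp
        then show ?thesis using n by (simp add: zero_less_mult_iff)
      qed
      have "sum (?a i) (words m) = sum ?b (words m)"
        using measure_pmf.sum_law[where V="block c (int i) m" and S="words m" and M=p] Q.sum_law[of "block (\<lambda>x. x) 0 m" "words m"]
        by (simp add: image_subset_iff)
      then show "shannon (measure_pmf p) (block c (int i) m) \<le> (\<Sum>v\<in>words m. - ?a i v * log 2 (?b v))"
        unfolding p.shannon_block_eq using pos by (intro gibbs(1)) auto
    qed
    also have "\<dots> = (\<Sum>v\<in>words m. - (\<Sum>i<n. ?a i v) * log 2 (?b v))"
      by (simp add: sum.swap[of _ "words m"] sum_distrib_right sum_negf)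
    also have "\<dots> = n * block_entropy Q (\<lambda>x. x) m"
      unfolding avg Q.block_entropy_eq Q.shannon_block_eq by (simp add: sum_distrib_left sum_negf algebra_simps)
    finally have windows: "(\<Sum>i<n. shannon (measure_pmf p) (block c (int i) m)) \<le> n * block_entropy Q (\<lambda>x. x) m" .
    \<comment> \<open>The point chosen for a word spells that word, so the block law is
      \<open>p\<close> itself and its entropy can be computed exactly.\<close>
    have law_c: "measure_pmf.law p (block c 0 n) u = pmf p u" for u
    proof -
      have "block c 0 n v = v" if "v \<in> set_pmf p" for v
      proof -
        have "v \<in> lang X n" using that by (auto simp: set_pmf_eq pmf_p split: if_splits)
        from c_cyl[OF this] this show ?thesis by (auto simp: cyl_def lang_def block_eq_iff)
      qed
      then have "{v. block c 0 n v = u} \<inter> set_pmf p = {u} \<inter> set_pmf p" by auto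
      then have "measure (measure_pmf p) {v. block c 0 n v = u} = measure (measure_pmf p) {u}"
        using measure_Int_set_pmf[of p "{v. block c 0 n v = u}"] measure_Int_set_pmf[of p "{u}"] by simp
      then show ?thesis by (simp add: measure_pmf.law_def vimage_def measure_pmf_single)
    qed
    have on: "(\<Sum>u\<in>words n. pmf p u * g u) = (\<Sum>u\<in>lang X n. pmf p u * g u)" for g
      by (intro sum.mono_neutral_right lang_subset_words) (auto simp: pmf_p)
    have "shannon (measure_pmf p) (block c 0 n) = (\<Sum>u\<in>lang X n. pmf p u * - log 2 (pmf p u))"
      unfolding p.shannon_block_eq law_c on[symmetric] by simp
    also have "\<dots> = (\<Sum>u\<in>lang X n. pmf p u * (log 2 ?Z) - pmf p u * weight f u)"
    proof (rule sum.cong[OF refl])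
      fix u assume "u \<in> lang X n"
      then have "log 2 (pmf p u) = weight f u - log 2 ?Z"
        using Z by (simp add: pmf_p log_divide_pos)
      then show "pmf p u * - log 2 (pmf p u) = pmf p u * log 2 ?Z - pmf p u * weight f u"
        by (simp only: minus_diff_eq right_diff_distrib)
    qed
    also have "\<dots> = (\<Sum>u\<in>lang X n. pmf p u * 1) * log 2 ?Z - (\<Sum>u\<in>lang X n. pmf p u * weight f u)"
      by (simp add: sum_subtractf sum_distrib_right)
    also have "(\<Sum>u\<in>lang X n. pmf p u * 1) = 1"
      unfolding on[symmetric] using measure_pmf.sum_law[where V="block c 0 n" and S="words n" and M=p] by (simp add: law_c image_subset_iff)
    also have "(\<Sum>u\<in>lang X n. pmf p u * weight f u) = (\<Sum>u\<in>words n. measure_pmf.law p (block c 0 n) u * (\<Sum>j<n. f (u ! j)))"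
      unfolding on law_c by (intro sum.cong) (auto simp: weight_def lang_def)
    also have "\<dots> = (\<Sum>j<n. \<Sum>b\<in>UNIV. measure_pmf.law p (\<lambda>u. c u (int j)) b * f b)"
      unfolding p.expected_weight by simp
    also have "\<dots> = (\<Sum>b\<in>UNIV. (\<Sum>j<n. measure_pmf.law p (\<lambda>u. c u (int j)) b) * f b)"
      by (subst sum.swap) (simp add: sum_distrib_right)
    also have "\<dots> = (\<Sum>b\<in>UNIV. n * Q.law (\<lambda>x. x 0) b * f b)"
    proof (rule sum.cong[OF refl])
      fix b
      have "simple_function Q (\<lambda>x. x 0)" by (intro simple_function_finite_state Q.measurable_state)
      from law_avg[OF this, of b] show "(\<Sum>j<n. measure_pmf.law p (\<lambda>u. c u (int j)) b) * f b = n * Q.law (\<lambda>x. x 0) b * f b"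
        by (simp add: funpow_shift)
    qed
    also have "\<dots> = n * (LINT x|Q. f (x 0))"
      unfolding expectation_coord[OF Q] by (simp add: sum_distrib_left mult.assoc)
    finally have "log 2 ?Z = shannon (measure_pmf p) (block c 0 n) + n * (LINT x|Q. f (x 0))" by simp
    \<comment> \<open>For two letters \<open>log 2 CARD('a)\<close> is 1; division by
      \<open>m * n\<close> turns the boundary term into \<open>2 * m / n\<close>.\<close>
    moreover have "m * shannon (measure_pmf p) (block c 0 n) \<le> n * block_entropy Q (\<lambda>x. x) m + 2 * real m * real m"
      using p.shannon_windows[OF m, of n] windows by simp
    ultimately have "m * log 2 ?Z \<le> n * block_entropy Q (\<lambda>x. x) m + 2 * real m * real m + m * n * (LINT x|Q. f (x 0))"
      by (simp add: algebra_simps)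
    then show ?thesis using m n by (simp add: field_simps)
  qed
  ultimately show ?thesis using Q that by blast
qed

section \<open>Limits of empirical measures and convergence of the pressure\<close>

lemma tendsto_mult_log:
  fixes a :: "nat \<Rightarrow> real"
  assumes a: "a \<longlonglongrightarrow> l" and nn: "\<And>k. 0 \<le> a k"
  shows "(\<lambda>k. a k * log 2 (a k)) \<longlonglongrightarrow> l * log 2 l"
proof (cases "l = 0")
  case False
  moreover have "0 \<le> l" using a nn by (intro LIMSEQ_le_const[of a l 0]) auto
  ultimately have "(\<lambda>k. log 2 (a k)) \<longlonglongrightarrow> log 2 l"
    by (intro tendsto_log tendsto_const a) auto
  then show ?thesis by (rule tendsto_mult[OF a])
next
  case True
  \<comment> \<open>\<open>log 2\<close> is discontinuous at 0, so a limit 0 needs its own estimate: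
    \<open>ln t \<le> t - 1\<close> at \<open>t = 1 / sqrt x\<close> gives a bound that vanishes
    with \<open>x\<close>.\<close>
  have bound: "\<bar>x * ln x\<bar> \<le> 2 * sqrt x" if x: "0 \<le> x" "x \<le> 1" for x :: real
  proof (cases "x = 0")
    case False
    then have s: "0 < sqrt x" using x by simp
    have "ln (1 / sqrt x) \<le> 1 / sqrt x - 1" using s by (intro ln_le_minus_one) auto
    moreover have "ln (1 / sqrt x) = - ln x / 2" using s x False ln_sqrt[of x] ln_inverse[of "sqrt x"]
      by (simp add: inverse_eq_divide)
    ultimately have "- ln x \<le> 2 / sqrt x" by simp
    then have "x * (- ln x) \<le> x * (2 / sqrt x)" using x by (intro mult_left_mono) auto
    also have "x * (2 / sqrt x) = 2 * (x / sqrt x)" by simp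
    also have "\<dots> = 2 * sqrt x" using real_div_sqrt[OF x(1)] by simp
    finally have "- (x * ln x) \<le> 2 * sqrt x" by simp
    moreover have "x * ln x \<le> 0" using x False by (simp add: mult_nonneg_nonpos)
    ultimately show ?thesis by (simp only: abs_of_nonpos)
  qed simp
  have "eventually (\<lambda>k. a k < 1) sequentially"
    using a True by (intro order_tendstoD(2)[of a l]) auto
  then have "eventually (\<lambda>k. norm (a k * ln (a k)) \<le> 2 * sqrt (a k)) sequentially"
  proof eventually_elim
    case (elim k)
    then show ?case using bound[of "a k"] nn[of k] by simp
  qed
  moreover have "(\<lambda>k. 2 * sqrt (a k)) \<longlonglongrightarrow> 0"
  proof -
    have "(\<lambda>k. 2 * sqrt (a k)) \<longlonglongrightarrow> 2 * sqrt l"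
      by (intro tendsto_mult tendsto_const tendsto_real_sqrt a)
    then show ?thesis by (simp add: True)
  qed
  ultimately have "(\<lambda>k. a k * ln (a k)) \<longlonglongrightarrow> 0"
    by (rule Lim_null_comparison)
  then have "(\<lambda>k. a k * ln (a k) / ln 2) \<longlonglongrightarrow> 0 / ln 2"
    by (intro tendsto_divide tendsto_const) auto
  then show ?thesis using True by (simp add: log_def)
qed

lemma block_law_cylinder:
  assumes \<mu>: "sets \<mu> = sets Sh" "prob_space \<mu>" and v: "length v = m"
  shows "prob_space.law \<mu> (block (\<lambda>x. x) 0 m) v = measure \<mu> (cylinder (int ` {..<m}) (\<lambda>i. v ! nat i))"
proof -
  have "block (\<lambda>x. x) 0 m -` {v} \<inter> space \<mu> = cylinder (int ` {..<m}) (\<lambda>i. v ! nat i)"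
    using v sets_eq_imp_space_eq[OF \<mu>(1)] by (auto simp: cylinder_def block_eq_iff)
  then show ?thesis by (simp add: prob_space.law_def[OF \<mu>(2)])
qed

lemma coord_law_cylinder:
  assumes \<mu>: "sets \<mu> = sets Sh" "prob_space \<mu>"
  shows "prob_space.law \<mu> (\<lambda>x. x i) b = measure \<mu> (cylinder {i} (\<lambda>_. b))"
proof -
  have "(\<lambda>x. x i) -` {b} \<inter> space \<mu> = cylinder {i} (\<lambda>_. b)"
    using sets_eq_imp_space_eq[OF \<mu>(1)] by (auto simp: cylinder_def)
  then show ?thesis by (simp add: prob_space.law_def[OF \<mu>(2)])
qed

text \<open>As \<open>X\<close> is closed, a point outside it shows in some central window a pattern
  that no point of \<open>X\<close> has. There are countably many such cylinders, each null.\<close>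

lemma AE_subshiftI:
  assumes X: "subshift X" and \<mu>: "sets \<mu> = sets Sh" "prob_space \<mu>"
    and null: "\<And>J u. finite J \<Longrightarrow> cylinder J u \<inter> X = {} \<Longrightarrow> measure \<mu> (cylinder J u) = 0"
  shows "AE x in \<mu>. x \<in> X"
proof -
  interpret prob_space \<mu> by fact
  let ?U = "\<lambda>n::nat. Pi\<^sub>E {- int n..int n} (\<lambda>_. UNIV :: bool set)"
  have "AE x in \<mu>. \<forall>u\<in>?U n. cylinder {- int n..int n} u \<inter> X = {} \<longrightarrow> x \<notin> cylinder {- int n..int n} u" for n
  proof (rule AE_finite_allI)
    show "finite (?U n)" by (rule box_decomposition(3)) simp
    fix u
    show "AE x in \<mu>. cylinder {- int n..int n} u \<inter> X = {} \<longrightarrow> x \<notin> cylinder {- int n..int n} u"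
    proof (cases "cylinder {- int n..int n} u \<inter> X = {}")
      case True
      have "cylinder {- int n..int n} u \<in> events" by (simp add: \<mu>)
      then show ?thesis using null[OF _ True] by (simp add: prob_eq_0)
    qed simp
  qed
  then have "AE x in \<mu>. \<forall>n. \<forall>u\<in>?U n. cylinder {- int n..int n} u \<inter> X = {} \<longrightarrow> x \<notin> cylinder {- int n..int n} u"
    by (simp add: AE_all_countable)
  then show ?thesis
  proof eventually_elim
    case (elim x)
    have "\<exists>y\<in>X. \<forall>i. \<bar>i\<bar> \<le> int n \<longrightarrow> y i = x i" for n
    proof -
      let ?J = "{- int n..int n}"
      have "restrict x ?J \<in> ?U n" "x \<in> cylinder ?J (restrict x ?J)" by (auto simp: cylinder_def)
      with elim obtain y where "y \<in> cylinder ?J (restrict x ?J)" "y \<in> X" by blast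
      then have "y i = x i" if "\<bar>i\<bar> \<le> int n" for i
      proof -
        have "i \<in> ?J" using that by auto
        then show ?thesis using \<open>y \<in> cylinder ?J (restrict x ?J)\<close> by (simp add: cylinder_def)
      qed
      then show ?thesis using \<open>y \<in> X\<close> by blast
    qed
    then show ?case using X unfolding subshift_def by blast
  qed
qed

text \<open>Misiurewicz' half of the variational principle: \<open>\<mu>\<close> is a limit of measures that average
  the weighted words of \<open>X\<close> along the shift.\<close>

lemma pressure_attained:
  fixes s :: "nat \<Rightarrow> nat"
  assumes X: "subshift X" "X \<noteq> {}"
    and s: "strict_mono s" "\<And>k. s k > 0" "\<And>k. L \<le> log 2 (partition_sum X f (s k)) / s k"
  obtains \<mu> where "\<mu> \<in> inv_meas_on X" "L \<le> ent \<mu> + (LINT x|\<mu>. f (x 0))"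
proof -
  have "\<exists>Q. sets Q = sets Sh \<and> prob_space Q \<and>
    (\<forall>E. E \<in> sets Sh \<longrightarrow> E \<inter> X = {} \<longrightarrow> measure Q E = 0) \<and>
    (\<forall>E. E \<in> sets Sh \<longrightarrow> \<bar>measure Q (shift -` E) - measure Q E\<bar> \<le> 1 / s k) \<and>
    (\<forall>m>0. log 2 (partition_sum X f (s k)) / s k
      \<le> block_entropy Q (\<lambda>x. x) m / m + 2 * m / s k + (LINT x|Q. f (x 0)))" for k
    by (rule empirical_measure[OF X s(2), of k f]) blast
  then obtain Q :: "nat \<Rightarrow> cfg measure" where Q: "\<And>k. sets (Q k) = sets Sh" "\<And>k. prob_space (Q k)"
    and null: "\<And>k E. E \<in> sets Sh \<Longrightarrow> E \<inter> X = {} \<Longrightarrow> measure (Q k) E = 0"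
    and inv: "\<And>k E. E \<in> sets Sh \<Longrightarrow> \<bar>measure (Q k) (shift -` E) - measure (Q k) E\<bar> \<le> 1 / s k"
    and ent: "\<And>k m. m > 0 \<Longrightarrow> log 2 (partition_sum X f (s k)) / s k
      \<le> block_entropy (Q k) (\<lambda>x. x) m / m + 2 * m / s k + (LINT x|Q k. f (x 0))"
    by metis
  obtain r \<mu> where r: "strict_mono (r :: nat \<Rightarrow> nat)" and \<mu>: "sets \<mu> = sets Sh" "prob_space \<mu>"
    and lim: "\<And>J u. finite J \<Longrightarrow> (\<lambda>k. measure (Q (r k)) (cylinder J u)) \<longlonglongrightarrow> measure \<mu> (cylinder J u)"
    using cylinder_compactness[of Q] Q by blast
  have sr: "strict_mono (s \<circ> r)" using s(1) r by (rule strict_mono_o)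
  have small: "(\<lambda>k. c / real (s (r k))) \<longlonglongrightarrow> 0" for c
    using LIMSEQ_subseq_LIMSEQ[OF lim_const_over_n[of c] sr] by (simp add: comp_def)
  have shift: "shift \<in> measurable \<mu> Sh" by (simp add: measurable_cong_sets[OF \<mu>(1) refl])
  \<comment> \<open>On a fixed cylinder the defect of invariance is at most
    \<open>1 / s (r k)\<close>, hence 0 in the limit.\<close>
  have "distr \<mu> Sh shift = \<mu>"
  proof (rule cfg_measure_eqI)
    show "prob_space (distr \<mu> Sh shift)" by (rule prob_space.prob_space_distr[OF \<mu>(2) shift])
    fix J u assume J: "finite (J :: int set)"
    have pre: "shift -` cylinder J u = cylinder ((\<lambda>i. i + 1) ` J) (\<lambda>i. u (i - 1))"
      by (auto simp: cylinder_def shift_def)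
    have "(\<lambda>k. measure (Q (r k)) (shift -` cylinder J u) - measure (Q (r k)) (cylinder J u))
        \<longlonglongrightarrow> measure \<mu> (shift -` cylinder J u) - measure \<mu> (cylinder J u)"
      unfolding pre using J by (intro tendsto_diff lim) auto
    moreover have "(\<lambda>k. measure (Q (r k)) (shift -` cylinder J u) - measure (Q (r k)) (cylinder J u)) \<longlonglongrightarrow> 0"
      using inv[of "cylinder J u"] J by (intro Lim_null_comparison[OF _ small[of 1]]) auto
    ultimately have "measure \<mu> (shift -` cylinder J u) = measure \<mu> (cylinder J u)"
      using LIMSEQ_unique by fastforce
    then show "measure (distr \<mu> Sh shift) (cylinder J u) = measure \<mu> (cylinder J u)"
      using J sets_eq_imp_space_eq[OF \<mu>(1)] by (simp add: measure_distr[OF shift])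
  qed (use \<mu> in auto)
  then have inv_\<mu>: "\<mu> \<in> inv_meas" using \<mu> by (simp add: inv_meas_def)
  have "AE x in \<mu>. x \<in> X"
  proof (rule AE_subshiftI[OF X(1) \<mu>])
    fix J u assume J: "finite J" and e: "cylinder J u \<inter> X = {}"
    have "(\<lambda>k. 0) \<longlonglongrightarrow> measure \<mu> (cylinder J u)"
      using lim[OF J, of u] null[OF cylinder_sets[OF J] e] by simp
    then show "measure \<mu> (cylinder J u) = 0" by (simp add: LIMSEQ_const_iff)
  qed
  then have \<mu>_X: "\<mu> \<in> inv_meas_on X" using inv_\<mu> by (simp add: inv_meas_on_def)
  interpret \<mu>: stationary_process \<mu> "\<lambda>x. x" by (rule stationary_inv_meas[OF inv_\<mu>])
  have be: "block_entropy \<nu> (\<lambda>x. x) m = (\<Sum>v\<in>words m. - (measure \<nu> (cylinder (int ` {..<m}) (\<lambda>i. v ! nat i))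
      * log 2 (measure \<nu> (cylinder (int ` {..<m}) (\<lambda>i. v ! nat i)))))"
    if \<nu>: "sets \<nu> = sets Sh" "prob_space \<nu>" for \<nu> m
  proof -
    interpret process \<nu> "\<lambda>x. x" using \<nu> by (rule process_cfg)
    show ?thesis
      unfolding block_entropy_eq shannon_block_eq
      by (intro sum.cong) (auto simp: words_def block_law_cylinder[OF \<nu>])
  qed
  \<comment> \<open>Order of limits: \<open>m\<close> stays fixed while \<open>k\<close> grows,
    which sends \<open>2 * m / s (r k)\<close> to the summand 0; only afterwards does
    \<open>m\<close> grow and the block entropy become \<open>ent \<mu>\<close>.\<close>
  have L: "L \<le> block_entropy \<mu> (\<lambda>x. x) m / m + 0 + (LINT x|\<mu>. f (x 0))" if m: "m > 0" for m
  proof (rule LIMSEQ_le_const)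
    show "(\<lambda>k. block_entropy (Q (r k)) (\<lambda>x. x) m / m + 2 * real m / s (r k) + (LINT x|Q (r k). f (x 0)))
      \<longlonglongrightarrow> block_entropy \<mu> (\<lambda>x. x) m / m + 0 + (LINT x|\<mu>. f (x 0))"
      unfolding expectation_coord[OF \<mu>] expectation_coord[OF Q] be[OF \<mu>] be[OF Q]
        coord_law_cylinder[OF \<mu>] coord_law_cylinder[OF Q]
      using m by (intro tendsto_add tendsto_divide tendsto_const tendsto_sum tendsto_mult tendsto_minus
          tendsto_mult_log lim small) auto
    show "\<exists>N. \<forall>k\<ge>N. L \<le> block_entropy (Q (r k)) (\<lambda>x. x) m / m + 2 * real m / s (r k) + (LINT x|Q (r k). f (x 0))"
      using order_trans[OF s(3) ent[OF m]] by blast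
  qed
  have "(\<lambda>m. block_entropy \<mu> (\<lambda>x. x) m / m + (LINT x|\<mu>. f (x 0))) \<longlonglongrightarrow> ent \<mu> + (LINT x|\<mu>. f (x 0))"
    unfolding ent_def by (intro tendsto_add tendsto_const \<mu>.ks_entropy_limit)
  then have "L \<le> ent \<mu> + (LINT x|\<mu>. f (x 0))"
    by (rule LIMSEQ_le_const) (use L in \<open>auto intro!: exI[of _ 1]\<close>)
  with \<mu>_X show ?thesis by (rule that)
qed

text \<open>\<open>pressure\<close> is a \<open>lim\<close>, so convergence itself has to be shown.
  Block entropies of \<mu> bound the sequence from below; if it were infinitely often at least some
  \<open>y\<close> above the maximum, \<open>pressure_attained\<close> would produce a measure
  beating that maximum.\<close>

lemma pressure_variational:
  assumes X: "subshift X" and \<mu>: "\<mu> \<in> inv_meas_on X"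
    and max: "\<And>\<nu>. \<nu> \<in> inv_meas_on X \<Longrightarrow>
      ent \<nu> + (LINT x|\<nu>. f (x 0)) \<le> ent \<mu> + (LINT x|\<mu>. f (x 0))"
  shows "pressure X (\<lambda>x. f (x 0)) = ent \<mu> + (LINT x|\<mu>. f (x 0))"
proof -
  let ?P = "ent \<mu> + (LINT x|\<mu>. f (x 0))" and ?a = "\<lambda>n. log 2 (partition_sum X f n) / n"
  have inv: "\<mu> \<in> inv_meas" and ae: "AE x in \<mu>. x \<in> X" using \<mu> by (auto simp: inv_meas_on_def)
  interpret \<mu>: stationary_process \<mu> "\<lambda>x. x" by (rule stationary_inv_meas[OF inv])
  have ne: "X \<noteq> {}" using ae by (auto simp: \<mu>.AE_False)
  have "?a \<longlonglongrightarrow> ?P"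
  proof (rule order_tendstoI)
    fix y assume y: "y < ?P"
    have "(\<lambda>n. block_entropy \<mu> (\<lambda>x. x) n / n + (LINT x|\<mu>. f (x 0))) \<longlonglongrightarrow> ?P"
      unfolding ent_def by (intro tendsto_add tendsto_const \<mu>.ks_entropy_limit)
    then have "eventually (\<lambda>n. y < block_entropy \<mu> (\<lambda>x. x) n / n + (LINT x|\<mu>. f (x 0))) sequentially"
      using y by (rule order_tendstoD(1))
    then show "eventually (\<lambda>n. y < ?a n) sequentially"
      using eventually_gt_at_top[of 0]
    proof eventually_elim
      case (elim n)
      have "block_entropy \<mu> (\<lambda>x. x) n / n + (LINT x|\<mu>. f (x 0))
          = (block_entropy \<mu> (\<lambda>x. x) n + n * (LINT x|\<mu>. f (x 0))) / n"
        using elim by (simp add: add_divide_distrib)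
      also have "\<dots> \<le> ?a n"
        by (intro divide_right_mono block_entropy_le_partition_sum \<mu>) simp
      finally show ?case using elim by simp
    qed
  next
    fix y assume y: "?P < y"
    show "eventually (\<lambda>n. ?a n < y) sequentially"
    proof (rule ccontr)
      assume "\<not> eventually (\<lambda>n. ?a n < y) sequentially"
      then have inf: "\<forall>N. \<exists>n\<ge>N. y \<le> ?a n"
        by (auto simp: eventually_sequentially not_less)
      \<comment> \<open>Averaging over \<open>n\<close> shifts requires positive lengths.\<close>
      have "infinite {n. n > 0 \<and> y \<le> ?a n}"
        unfolding infinite_nat_iff_unbounded
      proof
        fix N
        from inf obtain n where "n \<ge> Suc N" "y \<le> ?a n" by blast
        then show "\<exists>n>N. n \<in> {n. n > 0 \<and> y \<le> ?a n}" by (intro exI[of _ n]) auto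
      qed
      from infinite_enumerate[OF this] obtain s :: "nat \<Rightarrow> nat" where s: "strict_mono s"
        and s': "\<forall>k. s k \<in> {n. n > 0 \<and> y \<le> ?a n}"
        by blast
      from s' have "\<And>k. s k > 0" "\<And>k. y \<le> ?a (s k)" by simp_all
      from pressure_attained[OF X ne s this]
      obtain \<nu> where "\<nu> \<in> inv_meas_on X" "y \<le> ent \<nu> + (LINT x|\<nu>. f (x 0))" .
      then show False using max[of \<nu>] y by simp
    qed
  qed
  then show ?thesis unfolding pressure_eq by (rule limI)
qed

text \<open>For every joining \<open>cross_entropy\<close> plus the integral equals
  \<open>?P\<close>, so \<open>?F\<close> falls short of \<open>?P\<close> exactly by
  \<open>cross_entropy - ent\<close>. This deficit is nonnegative and vanishes only at the image of
  the product.\<close>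

lemma sandwich_equilibrium:
  fixes f :: "bool \<Rightarrow> real"
  defines "S \<equiv> 2 powr f False + 2 powr f True"
  assumes base: "base_measure X \<rho>" and ent0: "ent2 \<rho> = 0"
  shows "pressure X (\<lambda>x. f (x 0)) = rho_at \<rho> False False * f False + rho_at \<rho> True True * f True
           + rho_at \<rho> False True * log 2 S"
    and "{\<mu>. equilibrium_state X (\<lambda>x. f (x 0)) \<mu>} = {distr (\<rho> \<Otimes>\<^sub>M bernoulli_shift (2 powr f False / S)) Sh Nmap}"
proof -
  let ?p = "2 powr f False / S" and ?P = "rho_at \<rho> False False * f False + rho_at \<rho> True True * f True
           + rho_at \<rho> False True * log 2 S"
  have "S > 0" unfolding S_def by (intro add_pos_pos) auto
  then have p: "0 < ?p" "?p < 1" by (auto simp: S_def)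
  have X: "subshift X" and inv: "\<rho> \<in> inv_meas2" and ordered: "emeasure \<rho> {(w, x). \<forall>i. w i \<le> x i} = 1"
    and joinings: "inv_meas_on X = {distr L Sh Nmap | L. L \<in> inv_meas3 \<and> distr L Sh2 fst = \<rho>}"
    using base by (auto simp: base_measure_def sandwich_sub_def)
  let ?\<mu> = "distr (\<rho> \<Otimes>\<^sub>M bernoulli_shift ?p) Sh Nmap"
  let ?F = "\<lambda>\<nu>. ent \<nu> + (LINT x|\<nu>. f (x 0))"
  note prod = product_inv_meas3[OF inv, of ?p]
  have \<mu>: "?\<mu> \<in> inv_meas_on X" unfolding joinings using prod by blast
  have ub: "?F \<nu> \<le> ?P" and uniq: "?F \<nu> = ?P \<Longrightarrow> \<nu> = ?\<mu>" if \<nu>: "\<nu> \<in> inv_meas_on X" for \<nu>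
  proof -
    obtain L where L: "L \<in> inv_meas3" "distr L Sh2 fst = \<rho>" and \<nu>_eq: "\<nu> = distr L Sh Nmap"
      using \<nu> joinings by auto
    note ce = cross_entropy_eq[OF inv ordered L, of f, folded S_def]
    \<comment> \<open>Blocks of length 1 already give the bound; longer ones enter through
      uniqueness.\<close>
    have "ent \<nu> \<le> cross_entropy ?p L"
      using ent_factor_le[OF inv L ent0, of 1] joining_gibbs(1)[OF inv L p, of 1] by (simp add: \<nu>_eq)
    then show "?F \<nu> \<le> ?P" using ce by (simp add: \<nu>_eq)
    assume "?F \<nu> = ?P"
    then have "ent (distr L Sh Nmap) = cross_entropy ?p L" using ce by (simp add: \<nu>_eq)
    then show "\<nu> = ?\<mu>" unfolding \<nu>_eq by (rule joining_entropy_eqD[OF inv L ent0 p])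
  qed
  have "?P \<le> ?F ?\<mu>"
    using ent_product_ge[OF inv p] cross_entropy_eq[OF inv ordered prod, of f, folded S_def] by simp
  then have eq: "?F ?\<mu> = ?P" using ub[OF \<mu>] by simp
  show "pressure X (\<lambda>x. f (x 0)) = ?P"
    using pressure_variational[OF X \<mu>, of f] ub eq by simp
  show "{\<mu>. equilibrium_state X (\<lambda>x. f (x 0)) \<mu>} = {?\<mu>}"
  proof (intro set_eqI iffI)
    fix \<nu> assume "\<nu> \<in> {\<mu>. equilibrium_state X (\<lambda>x. f (x 0)) \<mu>}"
    then have "\<nu> \<in> inv_meas_on X" "?F ?\<mu> \<le> ?F \<nu>" using \<mu> by (auto simp: equilibrium_state_def)
    then have "?F \<nu> = ?P" using ub eq by (simp add: order_antisym)
    then show "\<nu> \<in> {?\<mu>}" using uniq \<open>\<nu> \<in> inv_meas_on X\<close> by simp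
  next
    fix \<nu> assume "\<nu> \<in> {?\<mu>}"
    then show "\<nu> \<in> {\<mu>. equilibrium_state X (\<lambda>x. f (x 0)) \<mu>}"
      using \<mu> ub eq by (simp add: equilibrium_state_def)
  qed
qed

theorem theorem5p4:
  fixes X :: "cfg set" and \<rho> :: "(cfg \<times> cfg) measure" and f :: "bool \<Rightarrow> real"
  assumes "base_measure X \<rho>"
    and "ent2 \<rho> = 0"
  shows "pressure X (\<lambda>x. f (x 0)) =
           rho_at \<rho> False False * f False + rho_at \<rho> True True * f True
           + rho_at \<rho> False True * log 2 (2 powr f False + 2 powr f True)
     \<and> {\<mu>. equilibrium_state X (\<lambda>x. f (x 0)) \<mu>} =
           {distr (\<rho> \<Otimes>\<^sub>M bernoulli_shift (2 powr f False / (2 powr f False + 2 powr f True)))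
              Sh Nmap}
     \<and> htop X = rho_at \<rho> False True
     \<and> htop X = measure \<rho> {(w, x). x 0 = True} - measure \<rho> {(w, x). w 0 = True}
     \<and> intrinsically_ergodic X
     \<and> {\<mu>. mme X \<mu>} = {distr (\<rho> \<Otimes>\<^sub>M bernoulli_shift (1/2)) Sh Nmap}"
proof -
  have base: "\<rho> \<in> inv_meas2" "emeasure \<rho> {(w, x). \<forall>i. w i \<le> x i} = 1"
    using assms(1) by (auto simp: base_measure_def sandwich_sub_def)
  have h: "htop X = rho_at \<rho> False True"
    using sandwich_equilibrium(1)[OF assms, of "\<lambda>_. 0"] by (simp add: htop_def)
  \<comment> \<open>For the zero potential the integral vanishes, and the formula for
    \<open>p\<close> gives \<open>1/2\<close>.\<close>
  have "mme X \<mu> \<longleftrightarrow> equilibrium_state X (\<lambda>x. (\<lambda>_. 0) (x 0)) \<mu>" for \<mu>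
    by (simp add: mme_def equilibrium_state_def)
  then have m: "{\<mu>. mme X \<mu>} = {distr (\<rho> \<Otimes>\<^sub>M bernoulli_shift (1/2)) Sh Nmap}"
    using sandwich_equilibrium(2)[OF assms, of "\<lambda>_. 0"] by simp
  then have "intrinsically_ergodic X"
    unfolding intrinsically_ergodic_def by (auto simp: set_eq_iff)
  then show ?thesis
    using sandwich_equilibrium[OF assms, of f] h m rho_at_marginals[OF base] by simp
qed

end
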